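(* Let $p$ be a prime, $f\geq 1$, $q=p^f$. Let $m=(m_0,m_1,\ldots,m_{f-1})$ and $n=(n_0,n_1,\ldots,n_{f-1})$ be tuples of non-negative integers. If $p\nmid\binom{m_i+n_i}{n_i}$ for all $0\leq i\leq f-1$, then there is an isomorphism of representations of $\mathrm{GL}_2(\mathbb{F}_q)$ over $\mathbb{F}_q$ $$m\otimes n\;\cong\;\bigoplus_{l\in\{0,1\}^f}\bigl(m-l+(\mathbf{1}_f-l)\odot n\bigr)\otimes\bigl(l\odot n-l\bigr)\otimes\mathrm{det}^{\psi_p(l)}.$$
   Context: For a tuple $m=(m_0,\ldots,m_{f-1})$ of non-negative integers, $m$ (also written $(m_0,\ldots,m_{f-1})$) denotes the representation of $\mathrm{GL}_2(\mathbb{F}_q)$ on the $\mathbb{F}_q$-space of multi-homogeneous polynomials over $\mathbb{F}_q$ in the variables $x_0,y_0,\ldots,x_{f-1},y_{f-1}$, of degree $m_i$ in $(x_i,y_i)$ for each $i$, where $\alpha=\begin{pmatrix}a&b\\c&d\end{pmatrix}$ acts by $\alpha\cdot\prod_{i}P_i(x_i,y_i)=\prod_{i}P_i(a^{p^i}x_i+c^{p^i}y_i,\,b^{p^i}x_i+d^{p^i}y_i)$. By convention, $(m_0,\ldots,m_{f-1})$ is the zero representation if some entry is negative. Tensor products are over $\mathbb{F}_q$ with diagonal action, and $\mathrm{det}^k$ is the one-dimensional representation given by the $k$-th power of the determinant. For $l\in\{0,1\}^f$, $\psi_p(l)=\sum_{j=0}^{f-1}l_jp^j$. The symbol $\odot$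 denotes the component-wise product in $\mathbb{Z}^f$, and $\mathbf{1}_f=(1,\ldots,1)\in\mathbb{Z}^f$. *)

theory Defs
  imports
    "HOL-Analysis.Determinants"
    "HOL-Algebra.Module"
    "HOL-Number_Theory.Residues"
    "HOL-Library.Poly_Mapping"
begin

section \<open>Representations\<close>

text \<open>
  The record type for modules extends the one for rings, so it has fields for a multiplication
  and a one on the module. They carry no information here and are left undefined below.
\<close>

record ('g, 'k, 'v) rep = "('k, 'v) module" +
  act :: "'g \<Rightarrow> 'v \<Rightarrow> 'v"

definition field_ring :: "'k::field ring" where
  "field_ring = \<lparr> carrier = UNIV, monoid.mult = (*), one = 1, ring.zero = 0, add = (+) \<rparr>"

locale representation = group G + Module.module R V
  for G :: "'g monoid" and R :: "'k ring" and V :: "('g, 'k, 'v) rep" +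
  assumes act_closed: "g \<in> carrier G \<Longrightarrow> v \<in> carrier V \<Longrightarrow> act V g v \<in> carrier V"
    and act_add: "g \<in> carrier G \<Longrightarrow> v \<in> carrier V \<Longrightarrow> w \<in> carrier V \<Longrightarrow>
      act V g (v \<oplus>\<^bsub>V\<^esub> w) = act V g v \<oplus>\<^bsub>V\<^esub> act V g w"
    and act_smult: "g \<in> carrier G \<Longrightarrow> c \<in> carrier R \<Longrightarrow> v \<in> carrier V \<Longrightarrow>
      act V g (c \<odot>\<^bsub>V\<^esub> v) = c \<odot>\<^bsub>V\<^esub> act V g v"
    and act_one: "v \<in> carrier V \<Longrightarrow> act V \<one>\<^bsub>G\<^esub> v = v"
    and act_mult: "g \<in> carrier G \<Longrightarrow> h \<in> carrier G \<Longrightarrow> v \<in> carrier V \<Longrightarrow>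
      act V (g \<otimes>\<^bsub>G\<^esub> h) v = act V g (act V h v)"

definition rep_isomorphic ::
    "'g monoid \<Rightarrow> 'k ring \<Rightarrow> ('g, 'k, 'v) rep \<Rightarrow> ('g, 'k, 'w) rep \<Rightarrow> bool" where
  "rep_isomorphic G R V W \<longleftrightarrow>
    (\<exists>\<phi> \<in> iso (add_monoid V) (add_monoid W).
      (\<forall>c\<in>carrier R. \<forall>v\<in>carrier V. \<phi> (c \<odot>\<^bsub>V\<^esub> v) = c \<odot>\<^bsub>W\<^esub> \<phi> v) \<and>
      (\<forall>g\<in>carrier G. \<forall>v\<in>carrier V. \<phi> (act V g v) = act W g (\<phi> v)))"

definition rep_direct_sum ::
    "'i set \<Rightarrow> ('i \<Rightarrow> ('g, 'k, 'v) rep) \<Rightarrow> ('g, 'k, 'i \<Rightarrow> 'v) rep" where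
  "rep_direct_sum I V =
    \<lparr> carrier = {x \<in> (\<Pi>\<^sub>E i\<in>I. carrier (V i)). finite {i \<in> I. x i \<noteq> \<zero>\<^bsub>V i\<^esub>}},
      monoid.mult = undefined, one = undefined,
      ring.zero = (\<lambda>i\<in>I. \<zero>\<^bsub>V i\<^esub>),
      add = (\<lambda>x y. \<lambda>i\<in>I. x i \<oplus>\<^bsub>V i\<^esub> y i),
      smult = (\<lambda>c x. \<lambda>i\<in>I. c \<odot>\<^bsub>V i\<^esub> x i),
      act = (\<lambda>g x. \<lambda>i\<in>I. act (V i) g (x i)) \<rparr>"


section \<open>Tensor products\<close>

text \<open>
  \<open>'b \<Rightarrow>\<^sub>0 'k\<close> is the vector space with basis \<open>'b\<close>; the basis vector of \<open>b\<close> is \<open>single b 1\<close>.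
\<close>

definition pm_scale :: "'k::field \<Rightarrow> ('b \<Rightarrow>\<^sub>0 'k) \<Rightarrow> ('b \<Rightarrow>\<^sub>0 'k)" where
  "pm_scale c F = Poly_Mapping.map ((*) c) F"

definition pm_extend :: "('b \<Rightarrow> ('c \<Rightarrow>\<^sub>0 'k)) \<Rightarrow> ('b \<Rightarrow>\<^sub>0 'k) \<Rightarrow> ('c \<Rightarrow>\<^sub>0 'k::field)" where
  "pm_extend h F = (\<Sum>b\<in>Poly_Mapping.keys F. pm_scale (Poly_Mapping.lookup F b) (h b))"

lemma lookup_pm_scale [simp]: "Poly_Mapping.lookup (pm_scale c F) b = c * Poly_Mapping.lookup F b"
  unfolding pm_scale_def by transfer (simp add: when_def)

interpretation pm: vector_space pm_scale
  by unfold_locales (auto intro!: poly_mapping_eqI simp: lookup_add algebra_simps)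

definition tensor_free ::
    "('g, 'k::field, 'v) rep \<Rightarrow> ('g, 'k, 'w) rep \<Rightarrow> ('v \<times> 'w \<Rightarrow>\<^sub>0 'k) set" where
  "tensor_free V W = {F. Poly_Mapping.keys F \<subseteq> carrier V \<times> carrier W}"

definition tensor_relations ::
    "('g, 'k::field, 'v) rep \<Rightarrow> ('g, 'k, 'w) rep \<Rightarrow> ('v \<times> 'w \<Rightarrow>\<^sub>0 'k) set" where
  "tensor_relations V W = pm.span (
     {Poly_Mapping.single (v \<oplus>\<^bsub>V\<^esub> v', w) 1
        - Poly_Mapping.single (v, w) 1 - Poly_Mapping.single (v', w) 1
      | v v' w. v \<in> carrier V \<and> v' \<in> carrier V \<and> w \<in> carrier W} \<union>
     {Poly_Mapping.single (v, w \<oplus>\<^bsub>W\<^esub> w') 1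
        - Poly_Mapping.single (v, w) 1 - Poly_Mapping.single (v, w') 1
      | v w w'. v \<in> carrier V \<and> w \<in> carrier W \<and> w' \<in> carrier W} \<union>
     {Poly_Mapping.single (c \<odot>\<^bsub>V\<^esub> v, w) 1 - pm_scale c (Poly_Mapping.single (v, w) 1)
      | c v w. v \<in> carrier V \<and> w \<in> carrier W} \<union>
     {Poly_Mapping.single (v, c \<odot>\<^bsub>W\<^esub> w) 1 - pm_scale c (Poly_Mapping.single (v, w) 1)
      | c v w. v \<in> carrier V \<and> w \<in> carrier W})"

definition tensor_class ::
    "('g, 'k::field, 'v) rep \<Rightarrow> ('g, 'k, 'w) rep \<Rightarrow>
      ('v \<times> 'w \<Rightarrow>\<^sub>0 'k) \<Rightarrow> ('v \<times> 'w \<Rightarrow>\<^sub>0 'k) set" where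
  "tensor_class V W F = {F + r | r. r \<in> tensor_relations V W}"

definition tensor_free_act ::
    "('g, 'k::field, 'v) rep \<Rightarrow> ('g, 'k, 'w) rep \<Rightarrow> 'g \<Rightarrow>
      ('v \<times> 'w \<Rightarrow>\<^sub>0 'k) \<Rightarrow> ('v \<times> 'w \<Rightarrow>\<^sub>0 'k)" where
  "tensor_free_act V W g =
    pm_extend (\<lambda>(v, w). Poly_Mapping.single (act V g v, act W g w) 1)"

text \<open>
  The elements of the tensor product are the cosets of the span of the bilinearity relations in
  the free vector space on pairs. Each operation on cosets is computed on representatives; the
  unions below are over sets that do not depend on the chosen representatives.
\<close>

definition rep_tensor ::
    "('g, 'k::field, 'v) rep \<Rightarrow> ('g, 'k, 'w) rep \<Rightarrow> ('g, 'k, ('v \<times> 'w \<Rightarrow>\<^sub>0 'k) set) rep"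
    (infixl \<open>\<otimes>\<^sub>r\<close> 70) where
  "V \<otimes>\<^sub>r W =
    \<lparr> carrier = tensor_class V W ` tensor_free V W,
      monoid.mult = undefined, one = undefined,
      ring.zero = tensor_class V W 0,
      add = (\<lambda>A B. \<Union>F\<in>A. \<Union>H\<in>B. tensor_class V W (F + H)),
      smult = (\<lambda>c A. \<Union>F\<in>A. tensor_class V W (pm_scale c F)),
      act = (\<lambda>g A. \<Union>F\<in>A. tensor_class V W (tensor_free_act V W g F)) \<rparr>"


section \<open>Representations of \<open>GL\<^sub>2\<close>\<close>

definition GL2 :: "('k::field^2^2) monoid" where
  "GL2 = \<lparr> carrier = {A. invertible A}, monoid.mult = (**), one = mat 1 \<rparr>"

definition det_rep :: "nat \<Rightarrow> ('k::field^2^2, 'k, 'k) rep" where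
  "det_rep k =
    \<lparr> carrier = UNIV, monoid.mult = undefined, one = undefined, ring.zero = 0, add = (+),
      smult = (*), act = (\<lambda>A v. det A ^ k * v) \<rparr>"

datatype xyvar = VarX nat | VarY nat

type_synonym 'k mpoly = "(xyvar \<Rightarrow>\<^sub>0 nat) \<Rightarrow>\<^sub>0 'k"

definition mvar :: "xyvar \<Rightarrow> 'k::field mpoly" where
  "mvar z = Poly_Mapping.single (Poly_Mapping.single z 1) 1"

definition mpoly_subst :: "(xyvar \<Rightarrow> 'k mpoly) \<Rightarrow> 'k mpoly \<Rightarrow> 'k::field mpoly" where
  "mpoly_subst \<sigma> =
    pm_extend (\<lambda>e. \<Prod>z\<in>Poly_Mapping.keys e. \<sigma> z ^ Poly_Mapping.lookup e z)"

text \<open>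
  If some \<open>k i\<close> with \<open>i < f\<close> is negative, no monomial qualifies and this is the zero space.
\<close>

definition multihom :: "nat \<Rightarrow> (nat \<Rightarrow> int) \<Rightarrow> 'k::field mpoly set" where
  "multihom f k = {P. \<forall>e\<in>Poly_Mapping.keys P.
     Poly_Mapping.keys e \<subseteq> VarX ` {..<f} \<union> VarY ` {..<f} \<and>
     (\<forall>i<f. int (Poly_Mapping.lookup e (VarX i) + Poly_Mapping.lookup e (VarY i)) = k i)}"

text \<open>
  \<open>mpoly_subst\<close> is linear and multiplicative, so substituting \<open>gl2_var p A\<close> sends a product
  \<open>\<Prod>i. P\<^sub>i(x\<^sub>i, y\<^sub>i)\<close> to the product of the \<open>P\<^sub>i\<close> at the \<open>p ^ i\<close>-power twisted linear forms.
\<close>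

primrec gl2_var :: "nat \<Rightarrow> 'k::field^2^2 \<Rightarrow> xyvar \<Rightarrow> 'k mpoly" where
  "gl2_var p A (VarX i) = pm_scale ((A$1$1) ^ (p ^ i)) (mvar (VarX i))
                      + pm_scale ((A$2$1) ^ (p ^ i)) (mvar (VarY i))"
| "gl2_var p A (VarY i) = pm_scale ((A$1$2) ^ (p ^ i)) (mvar (VarX i))
                      + pm_scale ((A$2$2) ^ (p ^ i)) (mvar (VarY i))"

definition poly_rep :: "nat \<Rightarrow> nat \<Rightarrow> (nat \<Rightarrow> int) \<Rightarrow> ('k::field^2^2, 'k, 'k mpoly) rep" where
  "poly_rep p f k =
    \<lparr> carrier = multihom f k, monoid.mult = undefined, one = undefined, ring.zero = 0,
      add = (+), smult = pm_scale, act = (\<lambda>A. mpoly_subst (gl2_var p A)) \<rparr>"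

definition psi :: "nat \<Rightarrow> nat \<Rightarrow> (nat \<Rightarrow> nat) \<Rightarrow> nat" where
  "psi p f l = (\<Sum>j<f. l j * p ^ j)"


section \<open>All constructions above are representations\<close>

lemma pm_extend_superset:
  assumes "finite S" "Poly_Mapping.keys F \<subseteq> S"
  shows "pm_extend h F = (\<Sum>b\<in>S. pm_scale (Poly_Mapping.lookup F b) (h b))"
  unfolding pm_extend_def
  by (rule sum.mono_neutral_left) (use assms in \<open>auto simp: in_keys_iff\<close>)

lemma pm_extend_linear:
  fixes h :: "'b \<Rightarrow> ('d \<Rightarrow>\<^sub>0 'c::field)"
  shows "module_hom pm_scale pm_scale (pm_extend h)"
proof (unfold_locales)
  fix F H :: "'b \<Rightarrow>\<^sub>0 'c::field"
  let ?S = "Poly_Mapping.keys F \<union> Poly_Mapping.keys H"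
  have "Poly_Mapping.keys (F + H) \<subseteq> ?S" by (rule Poly_Mapping.keys_add)
  then show "pm_extend h (F + H) = pm_extend h F + pm_extend h H"
    by (simp add: pm_extend_superset[of ?S] lookup_add pm.scale_left_distrib sum.distrib)
next
  fix c and F :: "'b \<Rightarrow>\<^sub>0 'c::field"
  have "Poly_Mapping.keys (pm_scale c F) \<subseteq> Poly_Mapping.keys F"
    by (auto simp: in_keys_iff)
  then show "pm_extend h (pm_scale c F) = pm_scale c (pm_extend h F)"
    by (simp add: pm_extend_superset[of "Poly_Mapping.keys F"] pm.scale_sum_right)
qed

lemma pm_extend_single [simp]: "pm_extend h (Poly_Mapping.single b c) = pm_scale c (h b)"
  by (simp add: pm_extend_superset[of "{b}"] lookup_single)

lemma pm_scale_single [simp]: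
  "pm_scale c (Poly_Mapping.single b d) = Poly_Mapping.single b (c * d)"
  by (auto intro!: poly_mapping_eqI simp: lookup_single when_def)

lemma pm_extend_add: "pm_extend h (F + H) = pm_extend h F + pm_extend h H"
  by (rule module_hom.add[OF pm_extend_linear])

lemma pm_extend_diff: "pm_extend h (F - H) = pm_extend h F - pm_extend h H"
  by (rule module_hom.diff[OF pm_extend_linear])

lemma pm_extend_scale: "pm_extend h (pm_scale c F) = pm_scale c (pm_extend h F)"
  by (rule module_hom.scale[OF pm_extend_linear])

lemma pm_extend_sum: "pm_extend h (sum F I) = (\<Sum>i\<in>I. pm_extend h (F i))"
  by (rule module_hom.sum[OF pm_extend_linear])

lemma pm_extend_basis: "pm_extend (\<lambda>b. Poly_Mapping.single b 1) F = F"
  by (rule poly_mapping_eqI)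
     (simp add: pm_extend_def lookup_sum lookup_single when_def in_keys_iff)

lemma pm_extend_compose: "pm_extend h (pm_extend h' F) = pm_extend (\<lambda>b. pm_extend h (h' b)) F"
  by (simp add: pm_extend_def[of h'] pm_extend_def[of "\<lambda>b. pm_extend h (h' b)"]
      pm_extend_sum pm_extend_scale)

lemma pm_extend_cong:
  "(\<And>b. b \<in> Poly_Mapping.keys F \<Longrightarrow> h b = h' b) \<Longrightarrow> pm_extend h F = pm_extend h' F"
  by (simp add: pm_extend_def)

lemma keys_pm_extend:
  "Poly_Mapping.keys (pm_extend h F) \<subseteq> (\<Union>b\<in>Poly_Mapping.keys F. Poly_Mapping.keys (h b))"
proof -
  have "Poly_Mapping.keys (pm_scale c (h b)) \<subseteq> Poly_Mapping.keys (h b)" for c b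
    by (auto simp: in_keys_iff)
  then show ?thesis
    unfolding pm_extend_def
    by (intro order_trans[OF Poly_Mapping.keys_sum]) blast
qed

lemma group_GL2: "group (GL2 :: ('k::field^2^2) monoid)"
proof (rule groupI)
  fix x :: "'k^2^2" assume "x \<in> carrier GL2"
  then obtain B where "x ** B = mat 1" "B ** x = mat 1"
    by (auto simp: GL2_def invertible_def)
  then show "\<exists>y\<in>carrier GL2. y \<otimes>\<^bsub>GL2\<^esub> x = \<one>\<^bsub>GL2\<^esub>"
    by (intro bexI[of _ B]) (auto simp: GL2_def invertible_def)
next
  fix x y :: "'k^2^2" assume "x \<in> carrier GL2" "y \<in> carrier GL2"
  then show "x \<otimes>\<^bsub>GL2\<^esub> y \<in> carrier GL2"
    by (simp add: GL2_def invertible_mult)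
next
  show "\<one>\<^bsub>GL2\<^esub> \<in> carrier (GL2 :: ('k^2^2) monoid)"
    by (auto simp: GL2_def invertible_def)
qed (simp_all add: GL2_def matrix_mul_assoc)

lemma field_ring_simps [simp]:
  "carrier field_ring = UNIV" "x \<otimes>\<^bsub>field_ring\<^esub> y = x * y" "x \<oplus>\<^bsub>field_ring\<^esub> y = x + y"
  "\<zero>\<^bsub>field_ring\<^esub> = 0" "\<one>\<^bsub>field_ring\<^esub> = 1"
  by (simp_all add: field_ring_def)

lemma cring_field_ring: "cring (field_ring :: 'k::field ring)"
proof (rule cringI)
  show "abelian_group (field_ring :: 'k ring)"
    by (rule abelian_groupI) (auto simp: algebra_simps intro: exI[of _ "- x" for x])
  show "Group.comm_monoid (field_ring :: 'k ring)"
    by unfold_locales (auto simp: algebra_simps)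
qed (simp add: algebra_simps)

lemma representationI:
  fixes G :: "'g monoid" and V :: "('g, 'k::field, 'v) rep"
  assumes "group G"
    and "abelian_group V"
    and "\<And>c x. x \<in> carrier V \<Longrightarrow> c \<odot>\<^bsub>V\<^esub> x \<in> carrier V"
    and "\<And>c d x. x \<in> carrier V \<Longrightarrow> (c + d) \<odot>\<^bsub>V\<^esub> x = c \<odot>\<^bsub>V\<^esub> x \<oplus>\<^bsub>V\<^esub> d \<odot>\<^bsub>V\<^esub> x"
    and "\<And>c x y. x \<in> carrier V \<Longrightarrow> y \<in> carrier V \<Longrightarrow>
      c \<odot>\<^bsub>V\<^esub> (x \<oplus>\<^bsub>V\<^esub> y) = c \<odot>\<^bsub>V\<^esub> x \<oplus>\<^bsub>V\<^esub> c \<odot>\<^bsub>V\<^esub> y"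
    and "\<And>c d x. x \<in> carrier V \<Longrightarrow> (c * d) \<odot>\<^bsub>V\<^esub> x = c \<odot>\<^bsub>V\<^esub> (d \<odot>\<^bsub>V\<^esub> x)"
    and "\<And>x. x \<in> carrier V \<Longrightarrow> 1 \<odot>\<^bsub>V\<^esub> x = x"
    and "\<And>g v. g \<in> carrier G \<Longrightarrow> v \<in> carrier V \<Longrightarrow> act V g v \<in> carrier V"
    and "\<And>g v w. g \<in> carrier G \<Longrightarrow> v \<in> carrier V \<Longrightarrow> w \<in> carrier V \<Longrightarrow>
      act V g (v \<oplus>\<^bsub>V\<^esub> w) = act V g v \<oplus>\<^bsub>V\<^esub> act V g w"
    and "\<And>g c v. g \<in> carrier G \<Longrightarrow> v \<in> carrier V \<Longrightarrow>
      act V g (c \<odot>\<^bsub>V\<^esub> v) = c \<odot>\<^bsub>V\<^esub> act V g v"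
    and "\<And>v. v \<in> carrier V \<Longrightarrow> act V \<one>\<^bsub>G\<^esub> v = v"
    and "\<And>g h v. g \<in> carrier G \<Longrightarrow> h \<in> carrier G \<Longrightarrow> v \<in> carrier V \<Longrightarrow>
      act V (g \<otimes>\<^bsub>G\<^esub> h) v = act V g (act V h v)"
  shows "representation G field_ring V"
proof -
  have "Module.module field_ring V"
    by (rule moduleI) (use assms cring_field_ring in auto)
  then show ?thesis
    unfolding representation_def representation_axioms_def using assms by auto
qed

lemma representation_det_rep: "representation GL2 field_ring (det_rep k)"
proof (rule representationI[OF group_GL2])
  show "abelian_group (det_rep k)"
    by (rule abelian_groupI) (auto simp: det_rep_def algebra_simps intro: exI[of _ "- x" for x])
qed (auto simp: det_rep_def GL2_def algebra_simps det_mul power_mult_distrib)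

lemma restrict_mem_rep_direct_sum:
  "(\<lambda>i\<in>I. h i) \<in> carrier (rep_direct_sum I V) \<longleftrightarrow>
    (\<forall>i\<in>I. h i \<in> carrier (V i)) \<and> finite {i \<in> I. h i \<noteq> \<zero>\<^bsub>V i\<^esub>}"
  by (auto simp: rep_direct_sum_def PiE_iff cong: conj_cong)

lemma representation_direct_sum:
  fixes V :: "'i \<Rightarrow> ('g, 'k::field, 'v) rep"
  assumes "group G" and V: "\<And>i. i \<in> I \<Longrightarrow> representation G field_ring (V i)"
  shows "representation G field_ring (rep_direct_sum I V)"
proof -
  have M: "Module.module field_ring (V i)" if "i \<in> I" for i
    using V[OF that] by (simp add: representation_def)
  have A: "abelian_group (V i)" if "i \<in> I" for i
    using M[OF that] by (simp add: Module.module_def)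
  note R = representation.act_closed[OF V] representation.act_add[OF V]
    representation.act_smult[OF V] representation.act_one[OF V] representation.act_mult[OF V]
  note AG = abelian_group.axioms(1)[OF A] 
  have cl: "x \<oplus>\<^bsub>V i\<^esub> y \<in> carrier (V i)" if "i \<in> I" "x \<in> carrier (V i)" "y \<in> carrier (V i)" for i x y
    using that abelian_monoid.a_closed[OF AG] by blast
  have z: "\<zero>\<^bsub>V i\<^esub> \<in> carrier (V i)" if "i \<in> I" for i
    using that abelian_monoid.zero_closed[OF AG] by blast
  have lz: "\<zero>\<^bsub>V i\<^esub> \<oplus>\<^bsub>V i\<^esub> x = x" if "i \<in> I" "x \<in> carrier (V i)" for i x
    using that abelian_monoid.l_zero[OF AG] by blast
  have smz: "c \<odot>\<^bsub>V i\<^esub> \<zero>\<^bsub>V i\<^esub> = \<zero>\<^bsub>V i\<^esub>" if "i \<in> I" for i c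
    using Module.module.smult_r_null[OF M[OF that]] by simp
  have actz: "act (V i) g \<zero>\<^bsub>V i\<^esub> = \<zero>\<^bsub>V i\<^esub>" if "i \<in> I" "g \<in> carrier G" for i g
    using R(3)[OF that(1) that(2), of 0 "\<zero>\<^bsub>V i\<^esub>"] z[OF that(1)]
      Module.module.smult_l_null[OF M[OF that(1)]] R(1)[OF that] by simp
  have negz: "\<ominus>\<^bsub>V i\<^esub> \<zero>\<^bsub>V i\<^esub> = \<zero>\<^bsub>V i\<^esub>" if "i \<in> I" for i
  proof -
    interpret abelian_group "V i" by (rule A) fact
    show ?thesis
      using l_neg[OF zero_closed] r_zero[OF a_inv_closed[OF zero_closed]] by simp
  qed
  have carrier_rds: "x \<in> carrier (rep_direct_sum I V) \<longleftrightarrow> x \<in> extensional I \<and>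
      (\<forall>i\<in>I. x i \<in> carrier (V i)) \<and> finite {i \<in> I. x i \<noteq> \<zero>\<^bsub>V i\<^esub>}" for x
    by (auto simp: rep_direct_sum_def PiE_iff)
  have add_rds: "x \<oplus>\<^bsub>rep_direct_sum I V\<^esub> y = (\<lambda>i\<in>I. x i \<oplus>\<^bsub>V i\<^esub> y i)"
    and smult_rds: "c \<odot>\<^bsub>rep_direct_sum I V\<^esub> x = (\<lambda>i\<in>I. c \<odot>\<^bsub>V i\<^esub> x i)"
    and act_rds: "act (rep_direct_sum I V) g x = (\<lambda>i\<in>I. act (V i) g (x i))" for x y c g
    by (simp_all add: rep_direct_sum_def)
  have ab: "abelian_group (rep_direct_sum I V)"
  proof (rule abelian_groupI)
    fix x y assume xy: "x \<in> carrier (rep_direct_sum I V)" "y \<in> carrier (rep_direct_sum I V)"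
    have "{i \<in> I. x i \<oplus>\<^bsub>V i\<^esub> y i \<noteq> \<zero>\<^bsub>V i\<^esub>}
        \<subseteq> {i \<in> I. x i \<noteq> \<zero>\<^bsub>V i\<^esub>} \<union> {i \<in> I. y i \<noteq> \<zero>\<^bsub>V i\<^esub>}"
      using lz z by auto
    then show "x \<oplus>\<^bsub>rep_direct_sum I V\<^esub> y \<in> carrier (rep_direct_sum I V)"
      using xy cl by (simp add: add_rds restrict_mem_rep_direct_sum)
        (auto simp: carrier_rds elim: finite_subset)
  next
    show "\<zero>\<^bsub>rep_direct_sum I V\<^esub> \<in> carrier (rep_direct_sum I V)"
      using z by (auto simp: rep_direct_sum_def)
  next
    fix x y w assume "x \<in> carrier (rep_direct_sum I V)" "y \<in> carrier (rep_direct_sum I V)"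
      "w \<in> carrier (rep_direct_sum I V)"
    then show "x \<oplus>\<^bsub>rep_direct_sum I V\<^esub> y \<oplus>\<^bsub>rep_direct_sum I V\<^esub> w =
      x \<oplus>\<^bsub>rep_direct_sum I V\<^esub> (y \<oplus>\<^bsub>rep_direct_sum I V\<^esub> w)"
      by (auto simp: rep_direct_sum_def fun_eq_iff PiE_iff intro!: abelian_monoid.a_assoc[OF AG])
  next
    fix x y assume "x \<in> carrier (rep_direct_sum I V)" "y \<in> carrier (rep_direct_sum I V)"
    then show "x \<oplus>\<^bsub>rep_direct_sum I V\<^esub> y = y \<oplus>\<^bsub>rep_direct_sum I V\<^esub> x"
      by (auto simp: rep_direct_sum_def fun_eq_iff PiE_iff intro!: abelian_monoid.a_comm[OF AG])
  next
    fix x assume x: "x \<in> carrier (rep_direct_sum I V)"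
    then show "\<zero>\<^bsub>rep_direct_sum I V\<^esub> \<oplus>\<^bsub>rep_direct_sum I V\<^esub> x = x"
      by (auto simp: rep_direct_sum_def fun_eq_iff PiE_iff extensional_def restrict_def lz)
    let ?y = "\<lambda>i\<in>I. \<ominus>\<^bsub>V i\<^esub> (x i)"
    have "{i \<in> I. \<ominus>\<^bsub>V i\<^esub> (x i) \<noteq> \<zero>\<^bsub>V i\<^esub>} \<subseteq> {i \<in> I. x i \<noteq> \<zero>\<^bsub>V i\<^esub>}"
      using negz by auto
    then have "?y \<in> carrier (rep_direct_sum I V)"
      using x abelian_group.a_inv_closed[OF A] by (simp add: restrict_mem_rep_direct_sum)
        (auto simp: carrier_rds elim: finite_subset)
    moreover have "?y \<oplus>\<^bsub>rep_direct_sum I V\<^esub> x = \<zero>\<^bsub>rep_direct_sum I V\<^esub>"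
      using x by (auto simp: rep_direct_sum_def fun_eq_iff PiE_iff abelian_group.l_neg[OF A])
    ultimately show "\<exists>y\<in>carrier (rep_direct_sum I V).
        y \<oplus>\<^bsub>rep_direct_sum I V\<^esub> x = \<zero>\<^bsub>rep_direct_sum I V\<^esub>" by blast
  qed
  show ?thesis
  proof (rule representationI[OF assms(1) ab])
    fix c x assume x: "x \<in> carrier (rep_direct_sum I V)"
    have "{i \<in> I. c \<odot>\<^bsub>V i\<^esub> x i \<noteq> \<zero>\<^bsub>V i\<^esub>} \<subseteq> {i \<in> I. x i \<noteq> \<zero>\<^bsub>V i\<^esub>}"
      using smz by auto
    then show "c \<odot>\<^bsub>rep_direct_sum I V\<^esub> x \<in> carrier (rep_direct_sum I V)"
      using x Module.module.smult_closed[OF M] by (simp add: smult_rds restrict_mem_rep_direct_sum)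
        (auto simp: carrier_rds elim: finite_subset)
  next
    fix g x assume g: "g \<in> carrier G" and x: "x \<in> carrier (rep_direct_sum I V)"
    have "{i \<in> I. act (V i) g (x i) \<noteq> \<zero>\<^bsub>V i\<^esub>} \<subseteq> {i \<in> I. x i \<noteq> \<zero>\<^bsub>V i\<^esub>}"
      using actz g by auto
    then show "act (rep_direct_sum I V) g x \<in> carrier (rep_direct_sum I V)"
      using x g R(1) by (simp add: act_rds restrict_mem_rep_direct_sum)
        (auto simp: carrier_rds elim: finite_subset)
  qed (auto simp: rep_direct_sum_def fun_eq_iff PiE_iff extensional_def restrict_def R
      Module.module.smult_l_distr[OF M, simplified] Module.module.smult_r_distr[OF M, simplified]
      Module.module.smult_assoc1[OF M, simplified] Module.module.smult_one[OF M, simplified])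
qed

lemma subspace_tensor_relations: "pm.subspace (tensor_relations V W)"
  by (simp add: tensor_relations_def pm.subspace_span)

lemma tensor_class_eq_iff:
  "tensor_class V W F = tensor_class V W H \<longleftrightarrow> F - H \<in> tensor_relations V W"
proof
  assume "tensor_class V W F = tensor_class V W H"
  moreover have "F \<in> tensor_class V W F"
    using pm.subspace_0[OF subspace_tensor_relations] by (force simp: tensor_class_def)
  ultimately show "F - H \<in> tensor_relations V W"
    by (auto simp: tensor_class_def)
next
  have sub: "tensor_class V W F \<subseteq> tensor_class V W H" if "F - H \<in> tensor_relations V W"
    for F H
  proof
    fix E assume "E \<in> tensor_class V W F"
    then obtain r where r: "r \<in> tensor_relations V W" "E = F + r" by (auto simp: tensor_class_def)
    then have "E = H + (F - H + r)" by simp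
    with r that pm.subspace_add[OF subspace_tensor_relations] show "E \<in> tensor_class V W H"
      unfolding tensor_class_def by blast
  qed
  assume "F - H \<in> tensor_relations V W"
  moreover from this have "H - F \<in> tensor_relations V W"
    using pm.subspace_neg[OF subspace_tensor_relations] by fastforce
  ultimately show "tensor_class V W F = tensor_class V W H"
    using sub by blast
qed

lemma mem_tensor_class: "H \<in> tensor_class V W F \<longleftrightarrow> H - F \<in> tensor_relations V W"
  by (auto simp: tensor_class_def) (metis add_diff_cancel_left' diff_add_cancel add.commute)

lemma mem_tensor_class_self: "F \<in> tensor_class V W F"
  using pm.subspace_0[OF subspace_tensor_relations] by (simp add: mem_tensor_class)

lemma tensor_free_act_relations:
  assumes "representation G field_ring V" "representation G field_ring W"
    and "g \<in> carrier G" and "r \<in> tensor_relations V W"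
  shows "tensor_free_act V W g r \<in> tensor_relations V W"
proof -
  interpret V: representation G "field_ring" V by fact
  interpret W: representation G "field_ring" W by fact
  note lin = pm_extend_linear
  have "tensor_free_act V W g ` tensor_relations V W \<subseteq> tensor_relations V W"
    unfolding tensor_relations_def tensor_free_act_def module_hom.span_image[OF lin, symmetric]
  proof (rule pm.span_minimal[OF _ pm.subspace_span], rule subsetI, rule pm.span_base,
      erule imageE, elim UnE CollectE exE conjE, goal_cases)
    case (1 x y v v' w)
    show ?case
      by (intro UnI1 CollectI exI[of _ "act V g v"] exI[of _ "act V g v'"] exI[of _ "act W g w"])
        (use 1 assms(3) in \<open>simp add: pm_extend_diff V.act_add V.act_closed W.act_closed\<close>)
  next
    case (2 x y v w w')
    show ?case
      by (rule UnI1, rule UnI1, rule UnI2)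
        (intro CollectI exI[of _ "act V g v"] exI[of _ "act W g w'"] exI[of _ "act W g w"],
         use 2 assms(3) in \<open>simp add: pm_extend_diff W.act_add V.act_closed W.act_closed\<close>)
  next
    case (3 x y c v w)
    show ?case
      by (rule UnI1, rule UnI2)
        (intro CollectI exI[of _ "act V g v"] exI[of _ c] exI[of _ "act W g w"],
         use 3 assms(3) in \<open>simp add: pm_extend_diff V.act_smult V.act_closed W.act_closed\<close>)
  next
    case (4 x y c v w)
    show ?case
      by (rule UnI2)
        (intro CollectI exI[of _ "act V g v"] exI[of _ c] exI[of _ "act W g w"],
         use 4 assms(3) in \<open>simp add: pm_extend_diff W.act_smult V.act_closed W.act_closed\<close>)
  qed
  with assms(4) show ?thesis by blast
qed

lemma tensor_zero: "\<zero>\<^bsub>V \<otimes>\<^sub>r W\<^esub> = tensor_class V W 0"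
  by (simp add: rep_tensor_def)

lemma tensor_carrier: "carrier (V \<otimes>\<^sub>r W) = tensor_class V W ` tensor_free V W"
  by (simp add: rep_tensor_def)

lemma UN_eq_constant: "(\<And>x. x \<in> A \<Longrightarrow> f x = c) \<Longrightarrow> a \<in> A \<Longrightarrow> (\<Union>x\<in>A. f x) = c"
  by auto

lemma tensor_add:
  "tensor_class V W F \<oplus>\<^bsub>V \<otimes>\<^sub>r W\<^esub> tensor_class V W H = tensor_class V W (F + H)"
proof -
  have "tensor_class V W (F' + H') = tensor_class V W (F + H)"
    if "F' \<in> tensor_class V W F" "H' \<in> tensor_class V W H" for F' H'
    using pm.subspace_add[OF subspace_tensor_relations, of "F' - F" V W "H' - H"] that
    by (simp add: mem_tensor_class tensor_class_eq_iff algebra_simps)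
  note * = this
  show ?thesis
    unfolding rep_tensor_def module.simps ring.simps monoid.simps partial_object.simps rep.simps
    by (intro UN_eq_constant[OF _ mem_tensor_class_self]; rule *)
qed

lemma tensor_smult:
  "c \<odot>\<^bsub>V \<otimes>\<^sub>r W\<^esub> tensor_class V W F = tensor_class V W (pm_scale c F)"
proof -
  have "tensor_class V W (pm_scale c F') = tensor_class V W (pm_scale c F)"
    if "F' \<in> tensor_class V W F" for F'
    using pm.subspace_scale[OF subspace_tensor_relations, of "F' - F" V W c] that
    by (simp add: mem_tensor_class tensor_class_eq_iff pm.scale_right_diff_distrib)
  note * = this
  show ?thesis
    unfolding rep_tensor_def module.simps ring.simps monoid.simps partial_object.simps rep.simps
    by (intro UN_eq_constant[OF _ mem_tensor_class_self]; rule *)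
qed

lemma tensor_act:
  assumes "representation G field_ring V" "representation G field_ring W"
    and "g \<in> carrier G"
  shows "act (V \<otimes>\<^sub>r W) g (tensor_class V W F) = tensor_class V W (tensor_free_act V W g F)"
proof -
  have "tensor_class V W (tensor_free_act V W g F') = tensor_class V W (tensor_free_act V W g F)"
    if "F' \<in> tensor_class V W F" for F'
    using tensor_free_act_relations[OF assms, of "F' - F"] that
    by (simp add: mem_tensor_class tensor_class_eq_iff tensor_free_act_def pm_extend_diff)
  note * = this
  show ?thesis
    unfolding rep_tensor_def module.simps ring.simps monoid.simps partial_object.simps rep.simps
    by (intro UN_eq_constant[OF _ mem_tensor_class_self]; rule *)
qed

lemma tensor_free_add: "F \<in> tensor_free V W \<Longrightarrow> H \<in> tensor_free V W \<Longrightarrow> F + H \<in> tensor_free V W"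
  unfolding tensor_free_def using Poly_Mapping.keys_add[of F H] by blast

lemma tensor_free_scale: "F \<in> tensor_free V W \<Longrightarrow> pm_scale c F \<in> tensor_free V W"
  by (auto simp: tensor_free_def in_keys_iff subset_iff)

lemma representation_tensor:
  assumes "representation G field_ring V" "representation G field_ring W"
  shows "representation G field_ring (V \<otimes>\<^sub>r W)"
proof -
  interpret V: representation G "field_ring" V by fact
  interpret W: representation G "field_ring" W by fact
  have fa: "tensor_free_act V W g F \<in> tensor_free V W"
    if "g \<in> carrier G" "F \<in> tensor_free V W" for g F
    unfolding tensor_free_def
  proof (intro CollectI subsetI)
    fix k assume "k \<in> Poly_Mapping.keys (tensor_free_act V W g F)"
    then obtain v w where "(v, w) \<in> Poly_Mapping.keys F" "k = (act V g v, act W g w)"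
      using keys_pm_extend[of "\<lambda>(v, w). Poly_Mapping.single (act V g v, act W g w) 1" F]
      unfolding tensor_free_act_def by auto
    then show "k \<in> carrier V \<times> carrier W"
      using that V.act_closed W.act_closed by (auto simp: tensor_free_def)
  qed
  have fa1: "tensor_free_act V W \<one>\<^bsub>G\<^esub> F = F" if "F \<in> tensor_free V W" for F
  proof -
    have "tensor_free_act V W \<one>\<^bsub>G\<^esub> F = pm_extend (\<lambda>b. Poly_Mapping.single b 1) F"
      unfolding tensor_free_act_def
      by (rule pm_extend_cong) (use that in \<open>auto simp: tensor_free_def V.act_one W.act_one\<close>)
    then show ?thesis by (simp add: pm_extend_basis)
  qed
  have fam: "tensor_free_act V W (g \<otimes>\<^bsub>G\<^esub> h) F = tensor_free_act V W g (tensor_free_act V W h F)"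
    if "g \<in> carrier G" "h \<in> carrier G" "F \<in> tensor_free V W" for g h F
    unfolding tensor_free_act_def pm_extend_compose
    by (rule pm_extend_cong) (use that in \<open>auto simp: tensor_free_def V.act_mult W.act_mult\<close>)
  note act = tensor_act[OF assms]
  show ?thesis
  proof (rule representationI[OF V.is_group])
    show "abelian_group (V \<otimes>\<^sub>r W)"
    proof (rule abelian_groupI)
      fix x assume "x \<in> carrier (V \<otimes>\<^sub>r W)"
      then obtain F where F: "F \<in> tensor_free V W" "x = tensor_class V W F"
        by (auto simp: tensor_carrier)
      have "- F \<in> tensor_free V W" using F(1) by (auto simp: tensor_free_def in_keys_iff subset_iff)
      then show "\<exists>y\<in>carrier (V \<otimes>\<^sub>r W). y \<oplus>\<^bsub>V \<otimes>\<^sub>r W\<^esub> x = \<zero>\<^bsub>V \<otimes>\<^sub>r W\<^esub>"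
        using F by (intro bexI[of _ "tensor_class V W (- F)"])
          (auto simp: tensor_add tensor_zero tensor_carrier)
    next
      show "\<zero>\<^bsub>V \<otimes>\<^sub>r W\<^esub> \<in> carrier (V \<otimes>\<^sub>r W)"
        by (auto simp: tensor_zero tensor_carrier tensor_free_def)
    qed (auto simp: tensor_carrier tensor_add tensor_zero tensor_free_add algebra_simps)
  qed (auto simp: tensor_carrier tensor_add tensor_smult act tensor_free_scale fa fa1 fam
      pm.scale_left_distrib pm.scale_right_distrib,
      simp_all add: tensor_free_act_def pm_extend_add pm_extend_scale)
qed

definition mpoly_mon :: "(xyvar \<Rightarrow> 'k mpoly) \<Rightarrow> (xyvar \<Rightarrow>\<^sub>0 nat) \<Rightarrow> 'k::field mpoly" where
  "mpoly_mon \<sigma> e = (\<Prod>z\<in>Poly_Mapping.keys e. \<sigma> z ^ Poly_Mapping.lookup e z)"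

lemma mpoly_subst_eq: "mpoly_subst \<sigma> = pm_extend (mpoly_mon \<sigma>)"
  by (simp add: mpoly_subst_def mpoly_mon_def[abs_def])

lemma mpoly_mon_superset:
  assumes "finite S" "Poly_Mapping.keys e \<subseteq> S"
  shows "mpoly_mon \<sigma> e = (\<Prod>z\<in>S. \<sigma> z ^ Poly_Mapping.lookup e z)"
  unfolding mpoly_mon_def
  by (rule prod.mono_neutral_left) (use assms in \<open>auto simp: in_keys_iff\<close>)

lemma mpoly_mon_0 [simp]: "mpoly_mon \<sigma> 0 = 1"
  by (simp add: mpoly_mon_def)

lemma mpoly_mon_add: "mpoly_mon \<sigma> (e + e') = mpoly_mon \<sigma> e * mpoly_mon \<sigma> e'"
proof -
  let ?S = "Poly_Mapping.keys e \<union> Poly_Mapping.keys e'"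
  have "Poly_Mapping.keys (e + e') \<subseteq> ?S" by (rule Poly_Mapping.keys_add)
  then show ?thesis
    by (simp add: mpoly_mon_superset[of ?S] lookup_add power_add prod.distrib)
qed

lemma pm_scale_mult_left: "pm_scale c F * H = pm_scale c (F * H :: 'k::field mpoly)"
  by (simp add: pm_scale_def mult_map_scale_conv_mult mult.assoc)

lemma pm_scale_mult_right: "F * pm_scale c H = pm_scale c (F * H :: 'k::field mpoly)"
  using pm_scale_mult_left[of c H F] by (simp add: mult.commute)

lemma mpoly_subst_single [simp]: "mpoly_subst \<sigma> (Poly_Mapping.single e c) = pm_scale c (mpoly_mon \<sigma> e)"
  by (simp add: mpoly_subst_eq)

lemma mpoly_expand:
  fixes F :: "'b \<Rightarrow>\<^sub>0 'k::field"
  shows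
  "F = (\<Sum>e\<in>Poly_Mapping.keys F. Poly_Mapping.single e (Poly_Mapping.lookup F e))"
  using pm_extend_basis[of F] by (simp add: pm_extend_def)

lemma mpoly_subst_mult: "mpoly_subst \<sigma> (P * Q) = mpoly_subst \<sigma> P * mpoly_subst \<sigma> Q"
proof -
  let ?s = "\<lambda>P e. Poly_Mapping.single e (Poly_Mapping.lookup P e)"
  have "mpoly_subst \<sigma> (P * Q) =
    mpoly_subst \<sigma> ((\<Sum>e\<in>Poly_Mapping.keys P. ?s P e) * (\<Sum>e\<in>Poly_Mapping.keys Q. ?s Q e))"
    using mpoly_expand[of P] mpoly_expand[of Q] by simp
  also have "\<dots> = (\<Sum>e\<in>Poly_Mapping.keys P. \<Sum>e'\<in>Poly_Mapping.keys Q.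
      mpoly_subst \<sigma> (?s P e * ?s Q e'))"
    by (simp add: sum_product mpoly_subst_eq pm_extend_sum)
  also have "\<dots> = (\<Sum>e\<in>Poly_Mapping.keys P. \<Sum>e'\<in>Poly_Mapping.keys Q.
      mpoly_subst \<sigma> (?s P e) * mpoly_subst \<sigma> (?s Q e'))"
    by (intro sum.cong refl)
      (simp add: mult_single mpoly_mon_add pm_scale_mult_left pm_scale_mult_right)
  also have "\<dots> = mpoly_subst \<sigma> P * mpoly_subst \<sigma> Q"
    by (simp add: sum_product mpoly_subst_eq pm_extend_def[of _ P] pm_extend_def[of _ Q])
  finally show ?thesis .
qed

lemma mpoly_subst_1 [simp]: "mpoly_subst \<sigma> 1 = 1"
  using mpoly_subst_single[of \<sigma> 0 1] by simp

lemma mpoly_subst_power: "mpoly_subst \<sigma> (P ^ n) = mpoly_subst \<sigma> P ^ n"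
  by (induction n) (auto simp: mpoly_subst_mult)

lemma mpoly_subst_prod: "mpoly_subst \<sigma> (prod P I) = (\<Prod>i\<in>I. mpoly_subst \<sigma> (P i))"
  by (induction I rule: infinite_finite_induct) (auto simp: mpoly_subst_mult)

lemma mpoly_subst_mvar [simp]: "mpoly_subst \<sigma> (mvar z) = \<sigma> z"
  by (simp add: mvar_def mpoly_mon_def)

lemma mpoly_subst_compose:
  "mpoly_subst \<sigma> (mpoly_subst \<tau> P) = mpoly_subst (\<lambda>z. mpoly_subst \<sigma> (\<tau> z)) P"
proof -
  have "mpoly_subst \<sigma> (mpoly_mon \<tau> e) = mpoly_mon (\<lambda>z. mpoly_subst \<sigma> (\<tau> z)) e" for e
    by (simp add: mpoly_mon_def mpoly_subst_prod mpoly_subst_power)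
  then show ?thesis
    by (simp add: mpoly_subst_eq[of \<tau>] mpoly_subst_eq[of \<sigma>] pm_extend_compose
      mpoly_subst_eq[of "\<lambda>z. pm_extend (mpoly_mon \<sigma>) (\<tau> z)"])
qed

lemma mvar_power: "mvar z ^ n = (Poly_Mapping.single (Poly_Mapping.single z n) 1 :: 'k::field mpoly)"
  by (induction n) (auto simp: mvar_def mult_single single_add[symmetric])

lemma mpoly_subst_mvar_id:
  fixes P :: "'k::field mpoly"
  shows "mpoly_subst mvar P = P"
proof -
  have prod: "(\<Prod>z\<in>S. Poly_Mapping.single (h z) (1::'k)) = Poly_Mapping.single (\<Sum>z\<in>S. h z) 1"
    if "finite S" for S and h :: "xyvar \<Rightarrow> xyvar \<Rightarrow>\<^sub>0 nat"
    using that by (induction S) (auto simp: mult_single)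
  have "(\<Sum>z\<in>Poly_Mapping.keys e. Poly_Mapping.single z (Poly_Mapping.lookup e z)) = e"
    for e :: "xyvar \<Rightarrow>\<^sub>0 nat"
    by (rule poly_mapping_eqI) (simp add: lookup_sum lookup_single when_def in_keys_iff)
  then have "mpoly_mon mvar = (\<lambda>e. Poly_Mapping.single e (1::'k))"
    by (simp add: mpoly_mon_def[abs_def] mvar_power prod)
  then have "mpoly_subst mvar P = pm_extend (\<lambda>b. Poly_Mapping.single b (1::'k)) P"
    by (simp add: mpoly_subst_eq)
  then show ?thesis by (simp add: pm_extend_basis)
qed

lemma multihom_0: "0 \<in> multihom f k"
  by (simp add: multihom_def)

lemma multihom_add: "P \<in> multihom f k \<Longrightarrow> Q \<in> multihom f k \<Longrightarrow> P + Q \<in> multihom f k"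
  using Poly_Mapping.keys_add[of P Q] unfolding multihom_def by blast

lemma multihom_scale: "P \<in> multihom f k \<Longrightarrow> pm_scale c P \<in> multihom f k"
  by (simp add: multihom_def in_keys_iff)

lemma multihom_mult:
  assumes "P \<in> multihom f k" "Q \<in> multihom f k'"
  shows "P * Q \<in> multihom f (\<lambda>i. k i + k' i)"
  unfolding multihom_def
proof (intro CollectI ballI)
  fix e assume "e \<in> Poly_Mapping.keys (P * Q)"
  then obtain a b where ab: "a \<in> Poly_Mapping.keys P" "b \<in> Poly_Mapping.keys Q" "e = a + b"
    using keys_mult[of P Q] by blast
  with assms have
    "Poly_Mapping.keys a \<subseteq> VarX ` {..<f} \<union> VarY ` {..<f}"
    "Poly_Mapping.keys b \<subseteq> VarX ` {..<f} \<union> VarY ` {..<f}"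
    "\<forall>i<f. int (Poly_Mapping.lookup a (VarX i) + Poly_Mapping.lookup a (VarY i)) = k i"
    "\<forall>i<f. int (Poly_Mapping.lookup b (VarX i) + Poly_Mapping.lookup b (VarY i)) = k' i"
    by (auto simp: multihom_def)
  with Poly_Mapping.keys_add[of a b] show
    "Poly_Mapping.keys e \<subseteq> VarX ` {..<f} \<union> VarY ` {..<f} \<and> (\<forall>i<f.
      int (Poly_Mapping.lookup e (VarX i) + Poly_Mapping.lookup e (VarY i)) = k i + k' i)"
    unfolding ab(3)
    proof (intro conjI allI impI)
      fix i assume "i < f"
      with \<open>\<forall>i<f. int (Poly_Mapping.lookup a (VarX i) + Poly_Mapping.lookup a (VarY i)) = k i\<close>
        \<open>\<forall>i<f. int (Poly_Mapping.lookup b (VarX i) + Poly_Mapping.lookup b (VarY i)) = k' i\<close>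
      show "int (Poly_Mapping.lookup (a + b) (VarX i) + Poly_Mapping.lookup (a + b) (VarY i)) = k i + k' i"
        by (force simp: lookup_add)
    qed blast
qed

lemma multihom_1: "1 \<in> multihom f (\<lambda>_. 0)"
  by (auto simp: multihom_def)

lemma multihom_power: "P \<in> multihom f k \<Longrightarrow> P ^ n \<in> multihom f (\<lambda>i. int n * k i)"
proof (induction n)
  case (Suc n)
  then have "P * P ^ n \<in> multihom f (\<lambda>i. k i + int n * k i)" by (intro multihom_mult) auto
  then show ?case by (simp add: algebra_simps)
qed (simp add: multihom_1)

lemma multihom_prod:
  assumes "finite S" "\<And>z. z \<in> S \<Longrightarrow> P z \<in> multihom f (k z)"
  shows "prod P S \<in> multihom f (\<lambda>i. \<Sum>z\<in>S. k z i)"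
  using assms
proof (induction S)
  case (insert z S)
  then have "P z * prod P S \<in> multihom f (\<lambda>i. k z i + (\<Sum>z\<in>S. k z i))"
    by (intro multihom_mult) auto
  then show ?case using insert by simp
qed (simp add: multihom_1)

lemma multihom_mvar:
  assumes "i < f"
  shows "mvar (VarX i) \<in> multihom f (\<lambda>j. of_bool (j = i))"
    "mvar (VarY i) \<in> multihom f (\<lambda>j. of_bool (j = i))"
  using assms by (auto simp: multihom_def mvar_def lookup_single)

primrec var_index :: "xyvar \<Rightarrow> nat" where "var_index (VarX i) = i" | "var_index (VarY i) = i"

lemma multihom_gl2_var:
  "var_index z < f \<Longrightarrow> gl2_var p A z \<in> multihom f (\<lambda>j. of_bool (j = var_index z))"
  by (cases z) (auto intro!: multihom_add multihom_scale multihom_mvar)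

lemma multihom_sum: "(\<And>i. i \<in> S \<Longrightarrow> P i \<in> multihom f k) \<Longrightarrow> sum P S \<in> multihom f k"
  by (induction S rule: infinite_finite_induct) (auto intro: multihom_0 multihom_add)

lemma multihom_cong: "(\<And>i. i < f \<Longrightarrow> k i = k' i) \<Longrightarrow> multihom f k = multihom f k'"
  by (auto simp: multihom_def)

lemma multihom_act:
  assumes P: "P \<in> multihom f k"
  shows "mpoly_subst (gl2_var p A) P \<in> multihom f k"
  unfolding mpoly_subst_eq pm_extend_def
proof (intro multihom_sum multihom_scale)
  fix e assume e: "e \<in> Poly_Mapping.keys P"
  let ?S = "VarX ` {..<f} \<union> VarY ` {..<f}"
  have sub: "Poly_Mapping.keys e \<subseteq> ?S"
    and deg: "\<And>i. i < f \<Longrightarrow>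
      int (Poly_Mapping.lookup e (VarX i)) + int (Poly_Mapping.lookup e (VarY i)) = k i"
    using P e by (auto simp: multihom_def)
  have "(\<Prod>z\<in>?S. gl2_var p A z ^ Poly_Mapping.lookup e z) \<in>
    multihom f (\<lambda>i. \<Sum>z\<in>?S. int (Poly_Mapping.lookup e z) * of_bool (i = var_index z))"
    by (intro multihom_prod multihom_power multihom_gl2_var) auto
  moreover have "(\<Sum>z\<in>?S. int (Poly_Mapping.lookup e z) * of_bool (i = var_index z)) = k i"
    if "i < f" for i
  proof -
    have "(\<Sum>z\<in>?S. int (Poly_Mapping.lookup e z) * of_bool (i = var_index z)) =
      (\<Sum>z\<in>{VarX i, VarY i}. int (Poly_Mapping.lookup e z))"
      by (rule sum.mono_neutral_cong_right) (use that in \<open>auto split: if_splits\<close>)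
    also have "\<dots> = k i" using deg[OF that] by simp
    finally show ?thesis .
  qed
  ultimately show "mpoly_mon (gl2_var p A) e \<in> multihom f k"
    unfolding mpoly_mon_superset[OF _ sub, simplified] by (subst multihom_cong[of f k]) auto
qed

lemma gl2_var_mult:
  fixes A B :: "'k::field^2^2"
  assumes frob: "\<And>(x::'k) y i. (x + y) ^ (p ^ i) = x ^ (p ^ i) + y ^ (p ^ i)"
  shows "gl2_var p (A ** B) z = mpoly_subst (gl2_var p A) (gl2_var p B z)"
  by (cases z) (simp_all add: mpoly_subst_eq pm_extend_add pm_extend_scale
      mpoly_subst_mvar[unfolded mpoly_subst_eq] matrix_matrix_mult_def sum_2 frob
      power_mult_distrib pm.scale_left_distrib pm.scale_right_distrib mult_ac add_ac)

lemma representation_poly_rep: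
  assumes "prime p" and card: "CARD('k::{field,finite}) = p ^ f"
  shows "representation (GL2 :: ('k^2^2) monoid) field_ring (poly_rep p f k)"
proof -
  have "CHAR('k) dvd p ^ f" using CHAR_dvd_CARD[where 'a = 'k] card by simp
  moreover have "prime CHAR('k)" by (rule prime_CHAR_semidom) (simp add: finite_imp_CHAR_pos)
  ultimately have ch: "CHAR('k) = p" using assms(1)
    by (metis prime_dvd_power primes_dvd_imp_eq)
  have frob: "(x + y) ^ (p ^ i) = x ^ (p ^ i) + y ^ (p ^ i)" for x y :: 'k and i
    using freshmans_dream'[where ?'a = 'k, of "p ^ i" i x y] \<open>prime p\<close> ch by simp
  show ?thesis
  proof (rule representationI[OF group_GL2])
    show "abelian_group (poly_rep p f k :: ('k^2^2, 'k, 'k mpoly) rep)"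
    proof (rule abelian_groupI)
      fix x :: "'k mpoly" assume "x \<in> carrier (poly_rep p f k)"
      then show "\<exists>y\<in>carrier (poly_rep p f k). y \<oplus>\<^bsub>poly_rep p f k\<^esub> x = \<zero>\<^bsub>poly_rep p f k\<^esub>"
        using multihom_scale[of x f k "- 1"]
        by (intro bexI[of _ "- x"]) (auto simp: poly_rep_def)
    qed (auto simp: poly_rep_def multihom_0 multihom_add add_ac)
  next
    fix v :: "'k mpoly"
    have "gl2_var p (mat 1 :: 'k^2^2) z = mvar z" for z
      using assms(1) by (cases z) (auto simp: mat_def prime_gt_0_nat)
    then have "gl2_var p (mat 1 :: 'k^2^2) = mvar" by (rule ext)
    then show "act (poly_rep p f k) \<one>\<^bsub>GL2\<^esub> v = v"
      by (simp add: poly_rep_def GL2_def mpoly_subst_mvar_id)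
  next
    fix g h :: "'k^2^2" and v
    show "act (poly_rep p f k) (g \<otimes>\<^bsub>GL2\<^esub> h) v = act (poly_rep p f k) g (act (poly_rep p f k) h v)"
      by (simp add: poly_rep_def GL2_def mpoly_subst_compose gl2_var_mult[OF frob, symmetric])
  qed (auto simp: poly_rep_def multihom_scale multihom_act pm.scale_left_distrib
      pm.scale_right_distrib mpoly_subst_eq pm_extend_add pm_extend_scale
      multihom_act[unfolded mpoly_subst_eq])
qed

end

theory Submission
  imports Defs
begin

text \<open>
  The proof is a Clebsch--Gordan decomposition, carried out one index \<open>i\<close> at a time inside a
  single polynomial ring. Over a field with \<open>q = p ^ f\<close> elements \<open>a ^ (p ^ (f + i)) = a ^ (p ^ i)\<close>,
  so the variables with index \<open>f + i\<close> transform exactly like those with index \<open>i\<close>. Therefore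
  \<open>P \<otimes> Q \<mapsto> P * shift f Q\<close>, where \<open>shift f\<close> raises every index by \<open>f\<close>, identifies a tensor product of
  two polynomial representations on \<open>f\<close> pairs of variables with a polynomial representation on
  \<open>f + f\<close> pairs (\<open>bij_tensor_lift_mult_shift\<close>). Both sides of the theorem are compared inside this
  model.

  Fix an index \<open>i\<close>, put \<open>j = f + i\<close>, and let the degrees in the pairs \<open>i\<close> and \<open>j\<close> be \<open>a\<close> and \<open>b\<close>. Two
  equivariant maps lead into this space. Multiplication by the bracket \<open>x\<^sub>i y\<^sub>j - y\<^sub>i x\<^sub>j\<close>, on which
  a matrix acts through the \<open>p ^ i\<close>-th power of its determinant, comes from bidegree
  \<open>(a - 1, b - 1)\<close>. Polarization comes from bidegree \<open>(a + b, 0)\<close>: it takes the part of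
  degree \<open>b\<close> in the pair \<open>j\<close> of \<open>P(x\<^sub>i + x\<^sub>j, y\<^sub>i + y\<^sub>j)\<close>. Setting the pair \<open>j\<close> equal to the pair \<open>i\<close> kills
  the bracket and turns the polarization of \<open>P\<close> into \<open>(a + b) choose b\<close> times \<open>P\<close>
  (\<open>merge_polarize\<close>), a nonzero multiple by hypothesis. Since multiplication by the bracket is
  injective, the two images are independent (\<open>polarize_bracket_independent\<close>).

  Composing over all \<open>i\<close> one of the two maps, polarization if \<open>l i = 0\<close> and the bracket if \<open>l i = 1\<close>,
  embeds the summand of \<open>l\<close> into the model, up to the character \<open>det ^ psi p f l\<close>
  (\<open>embed_summand_act\<close>). By induction on the number of indices the summands are
  independent. They fill the model because everything is finite and
  \<open>(a + 1) * (b + 1) = (a + b + 1) + a * b\<close> in each index makes the cardinalities agree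
  (\<open>bij_sum_embed_summand\<close>).
\<close>

section \<open>Multihomogeneous polynomials and their number\<close>

definition exponents :: "nat \<Rightarrow> (nat \<Rightarrow> int) \<Rightarrow> (xyvar \<Rightarrow>\<^sub>0 nat) set" where
  "exponents F k = {e. Poly_Mapping.keys e \<subseteq> VarX ` {..<F} \<union> VarY ` {..<F} \<and>
     (\<forall>i<F. int (Poly_Mapping.lookup e (VarX i) + Poly_Mapping.lookup e (VarY i)) = k i)}"

lemma multihom_eq: "multihom F k = {P. Poly_Mapping.keys P \<subseteq> exponents F k}"
  by (auto simp: multihom_def exponents_def)

lemma single_in_multihom: "e \<in> exponents F k \<Longrightarrow> Poly_Mapping.single e c \<in> multihom F k"
  by (simp add: multihom_eq)

lemma exponents_iff: "e \<in> exponents F k \<longleftrightarrow>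
    (\<forall>i\<ge>F. Poly_Mapping.lookup e (VarX i) = 0 \<and> Poly_Mapping.lookup e (VarY i) = 0) \<and>
    (\<forall>i<F. int (Poly_Mapping.lookup e (VarX i) + Poly_Mapping.lookup e (VarY i)) = k i)"
proof -
  have "Poly_Mapping.keys e \<subseteq> VarX ` {..<F} \<union> VarY ` {..<F} \<longleftrightarrow>
    (\<forall>i\<ge>F. Poly_Mapping.lookup e (VarX i) = 0 \<and> Poly_Mapping.lookup e (VarY i) = 0)"
    (is "?L \<longleftrightarrow> ?R")
  proof
    assume ?L then show ?R by (force simp: in_keys_iff subset_iff)
  next
    assume R: ?R
    show ?L
    proof
      fix z assume "z \<in> Poly_Mapping.keys e"
      then have "var_index z < F"
        using R by (cases z) (metis in_keys_iff not_le_imp_less var_index.simps)+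
      then show "z \<in> VarX ` {..<F} \<union> VarY ` {..<F}" by (cases z) auto
    qed
  qed
  then show ?thesis by (simp add: exponents_def)
qed

lemma multihom_diff: "P \<in> multihom F k \<Longrightarrow> Q \<in> multihom F k \<Longrightarrow> P - Q \<in> multihom F k"
  using multihom_add[of P F k "pm_scale (- 1) Q"] multihom_scale[of Q F k "- 1"] by simp

lemma subspace_multihom: "pm.subspace (multihom F k)"
  by (simp add: pm.subspace_def multihom_0 multihom_add multihom_scale)

lemma pm_extend_0 [simp]: "pm_extend h 0 = 0"
  by (simp add: pm_extend_def)

lemma pm_linear_ext:
  fixes P :: "'b \<Rightarrow>\<^sub>0 'k::field"
  assumes "\<And>P Q. g (P + Q) = g P + g Q" "\<And>P Q. h (P + Q) = h P + h Q"
    and "\<And>c P. g (pm_scale c P) = pm_scale c (g P)" "\<And>c P. h (pm_scale c P) = pm_scale c (h P)"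
    and "\<And>e. e \<in> Poly_Mapping.keys P \<Longrightarrow> g (Poly_Mapping.single e 1) = h (Poly_Mapping.single e 1)"
  shows "g P = (h P :: 'c \<Rightarrow>\<^sub>0 'k)"
proof -
  interpret g: module_hom pm_scale pm_scale g using assms by unfold_locales auto
  interpret h: module_hom pm_scale pm_scale h using assms by unfold_locales auto
  have "P = (\<Sum>e\<in>Poly_Mapping.keys P. pm_scale (Poly_Mapping.lookup P e) (Poly_Mapping.single e 1))"
    by (subst mpoly_expand) simp
  then show ?thesis
    using assms(5) by (metis (mono_tags, lifting) g.sum h.sum g.scale h.scale sum.cong)
qed

lemma mpoly_subst_add: "mpoly_subst \<sigma> (P + Q) = mpoly_subst \<sigma> P + mpoly_subst \<sigma> Q"
  and mpoly_subst_diff: "mpoly_subst \<sigma> (P - Q) = mpoly_subst \<sigma> P - mpoly_subst \<sigma> Q"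
  and mpoly_subst_scale: "mpoly_subst \<sigma> (pm_scale c P) = pm_scale c (mpoly_subst \<sigma> P)"
  and mpoly_subst_sum: "mpoly_subst \<sigma> (sum g I) = (\<Sum>i\<in>I. mpoly_subst \<sigma> (g i))"
  by (simp_all add: mpoly_subst_eq pm_extend_add pm_extend_diff pm_extend_scale pm_extend_sum)

lemma mpoly_mon_mvar [simp]: "mpoly_mon mvar e = (Poly_Mapping.single e 1 :: 'k::field mpoly)"
  using mpoly_subst_mvar_id[of "Poly_Mapping.single e (1::'k)"] by simp

lemma mpoly_mon_single [simp]: "mpoly_mon \<sigma> (Poly_Mapping.single z n) = \<sigma> z ^ n"
  by (simp add: mpoly_mon_superset[of "{z}"])

lemma mpoly_mon_cong:
  "(\<And>z. z \<in> Poly_Mapping.keys e \<Longrightarrow> \<sigma> z = \<tau> z) \<Longrightarrow> mpoly_mon \<sigma> e = mpoly_mon \<tau> e"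
  by (simp add: mpoly_mon_def)

lemma mpoly_subst_0 [simp]: "mpoly_subst \<sigma> 0 = 0"
  by (simp add: mpoly_subst_eq)

lemma card_supported:
  assumes "finite S"
  shows "finite {P :: 'b \<Rightarrow>\<^sub>0 'k::{zero,finite}. Poly_Mapping.keys P \<subseteq> S}"
    and "card {P :: 'b \<Rightarrow>\<^sub>0 'k. Poly_Mapping.keys P \<subseteq> S} = CARD('k) ^ card S"
proof -
  have "bij_betw (\<lambda>P. restrict (Poly_Mapping.lookup P) S)
    {P :: 'b \<Rightarrow>\<^sub>0 'k. Poly_Mapping.keys P \<subseteq> S} (S \<rightarrow>\<^sub>E UNIV)"
  proof (rule bij_betw_byWitness[where f' = "\<lambda>g. Abs_poly_mapping (\<lambda>b. if b \<in> S then g b else 0)"])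
    have fin: "finite {b. (if b \<in> S then g b else 0) \<noteq> 0}" for g :: "'b \<Rightarrow> 'k"
      by (rule finite_subset[OF _ assms]) auto
    show "\<forall>P\<in>{P :: 'b \<Rightarrow>\<^sub>0 'k. Poly_Mapping.keys P \<subseteq> S}. Abs_poly_mapping
        (\<lambda>b. if b \<in> S then restrict (Poly_Mapping.lookup P) S b else 0) = P"
      using fin by (auto intro!: poly_mapping_eqI simp: in_keys_iff subset_iff)
    show "\<forall>g\<in>S \<rightarrow>\<^sub>E UNIV. restrict (Poly_Mapping.lookup
        (Abs_poly_mapping (\<lambda>b. if b \<in> S then g b else (0::'k)))) S = g"
      using fin by (auto simp: fun_eq_iff PiE_iff extensional_def)
    show "(\<lambda>g. Abs_poly_mapping (\<lambda>b. if b \<in> S then g b else (0::'k))) ` (S \<rightarrow>\<^sub>E UNIV)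
        \<subseteq> {P. Poly_Mapping.keys P \<subseteq> S}"
      using fin by (auto simp: in_keys_iff split: if_splits)
  qed auto
  moreover have "finite (S \<rightarrow>\<^sub>E (UNIV :: 'k set))" using assms by (intro finite_PiE) auto
  ultimately show "finite {P :: 'b \<Rightarrow>\<^sub>0 'k. Poly_Mapping.keys P \<subseteq> S}"
    "card {P :: 'b \<Rightarrow>\<^sub>0 'k. Poly_Mapping.keys P \<subseteq> S} = CARD('k) ^ card S"
    using assms by (auto simp: bij_betw_finite bij_betw_same_card card_PiE)
qed

lemma card_exponents:
  "finite (exponents F k)" "card (exponents F k) = (\<Prod>i<F. nat (k i + 1))"
proof -
  let ?to = "\<lambda>e. \<lambda>i\<in>{..<F}. Poly_Mapping.lookup e (VarX i)"
  let ?from = "\<lambda>g. \<Sum>i<F. Poly_Mapping.single (VarX i) (g i) + Poly_Mapping.single (VarY i) (nat (k i) - g i)"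
  have X: "Poly_Mapping.lookup (?from g) (VarX i) = (if i < F then g i else 0)" for g i
    by (simp add: lookup_sum lookup_add sum.distrib lookup_single when_def)
  have Y: "Poly_Mapping.lookup (?from g) (VarY i) = (if i < F then nat (k i) - g i else 0)" for g i
    by (simp add: lookup_sum lookup_add sum.distrib lookup_single when_def)
  have supp: "Poly_Mapping.lookup e (VarX i) = 0" "Poly_Mapping.lookup e (VarY i) = 0"
    if "e \<in> exponents F k" "\<not> i < F" for e i
    using that by (force simp: exponents_def in_keys_iff subset_iff)+
  have deg: "int (Poly_Mapping.lookup e (VarX i)) + int (Poly_Mapping.lookup e (VarY i)) = k i"
    if "e \<in> exponents F k" "i < F" for e i
    using that by (auto simp: exponents_def)
  have "bij_betw ?to (exponents F k) (\<Pi>\<^sub>E i\<in>{..<F}. {..<nat (k i + 1)})"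
  proof (rule bij_betw_byWitness[where f' = ?from])
    show "\<forall>e\<in>exponents F k. ?from (?to e) = e"
    proof
      fix e assume e: "e \<in> exponents F k"
      show "?from (?to e) = e"
      proof (rule poly_mapping_eqI)
        fix z
        show "Poly_Mapping.lookup (?from (?to e)) z = Poly_Mapping.lookup e z"
        proof (cases z)
          case (VarX i)
          then show ?thesis using supp[OF e, of i] by (auto simp: X)
        next
          case (VarY i)
          then show ?thesis using supp[OF e, of i] deg[OF e, of i] by (auto simp: Y)
        qed
      qed
    qed
    show "\<forall>g\<in>\<Pi>\<^sub>E i\<in>{..<F}. {..<nat (k i + 1)}. ?to (?from g) = g"
      by (auto simp: X fun_eq_iff PiE_iff extensional_def)
    show "?to ` exponents F k \<subseteq> (\<Pi>\<^sub>E i\<in>{..<F}. {..<nat (k i + 1)})"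
      using deg by (force simp: PiE_iff)
    show "?from ` (\<Pi>\<^sub>E i\<in>{..<F}. {..<nat (k i + 1)}) \<subseteq> exponents F k"
    proof (rule image_subsetI)
      fix g assume g: "g \<in> (\<Pi>\<^sub>E i\<in>{..<F}. {..<nat (k i + 1)})"
      have "z \<in> VarX ` {..<F} \<union> VarY ` {..<F}" if "z \<in> Poly_Mapping.keys (?from g)" for z
        using that by (cases z) (auto simp: in_keys_iff X Y split: if_splits)
      moreover have "g i < nat (k i + 1)" if "i < F" for i using g that by (auto simp: PiE_iff)
      then have "int (g i + (nat (k i) - g i)) = k i" if "i < F" for i
        using that by fastforce
      ultimately show "?from g \<in> exponents F k"
        unfolding exponents_def by (auto simp: X Y simp del: of_nat_add)
    qed
  qed
  moreover have "finite (\<Pi>\<^sub>E i\<in>{..<F}. {..<nat (k i + 1)})" by (intro finite_PiE) auto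
  ultimately show "finite (exponents F k)" "card (exponents F k) = (\<Prod>i<F. nat (k i + 1))"
    by (auto simp: bij_betw_finite bij_betw_same_card card_PiE)
qed

text \<open>
  A factor vanishes if its degree is negative; the cardinality is then \<open>1\<close>, that of the zero space.
\<close>

lemma card_multihom:
  "finite (multihom F k :: 'k::{field,finite} mpoly set)"
  "card (multihom F k :: 'k mpoly set) = CARD('k) ^ (\<Prod>i<F. nat (k i + 1))"
  unfolding multihom_eq using card_supported card_exponents by (metis, metis)

section \<open>The bracket of two pairs of variables\<close>

definition bracket :: "nat \<Rightarrow> nat \<Rightarrow> 'k::field mpoly" where
  "bracket i j = mvar (VarX i) * mvar (VarY j) - mvar (VarY i) * mvar (VarX j)"

lemma lookup_monomial_mult:
  fixes R :: "'k::field mpoly"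
  shows "Poly_Mapping.lookup (Poly_Mapping.single a 1 * R) (a + e) = Poly_Mapping.lookup R e"
proof -
  have "Poly_Mapping.single a 1 * R =
      (\<Sum>e\<in>Poly_Mapping.keys R. Poly_Mapping.single (a + e) (Poly_Mapping.lookup R e))"
    by (subst mpoly_expand[of R]) (simp add: sum_distrib_left mult_single)
  then show ?thesis by (simp add: lookup_sum lookup_single when_def in_keys_iff)
qed

text \<open>
  Among the exponents of \<open>R\<close> of largest degree in \<open>x\<^sub>i\<close>, none can be cancelled after multiplication by
  \<open>x\<^sub>i y\<^sub>j\<close>: the other product \<open>y\<^sub>i x\<^sub>j R\<close> has smaller degree in \<open>x\<^sub>i\<close>.
\<close>

lemma bracket_mult_eq_0:
  fixes R :: "'k::field mpoly"
  assumes "i \<noteq> j" "bracket i j * R = 0"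
  shows "R = 0"
proof (rule ccontr)
  assume "R \<noteq> 0"
  let ?a = "Poly_Mapping.single (VarX i) 1 + Poly_Mapping.single (VarY j) (1::nat)"
  let ?b = "Poly_Mapping.single (VarY i) 1 + Poly_Mapping.single (VarX j) (1::nat)"
  let ?d = "\<lambda>e. Poly_Mapping.lookup e (VarX i)"
  define M where "M = Max (?d ` Poly_Mapping.keys R)"
  have fin: "finite (?d ` Poly_Mapping.keys R)" and "?d ` Poly_Mapping.keys R \<noteq> {}"
    using \<open>R \<noteq> 0\<close> by auto
  from Max_in[OF this] obtain e where e: "e \<in> Poly_Mapping.keys R" and "?d e = M"
    by (auto simp: M_def)
  then have max: "?d e' \<le> ?d e" if "e' \<in> Poly_Mapping.keys R" for e'
    using Max_ge[OF fin] that by (auto simp: M_def)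
  have "?a + e \<notin> Poly_Mapping.keys (Poly_Mapping.single ?b 1 * R)"
  proof
    assume "?a + e \<in> Poly_Mapping.keys (Poly_Mapping.single ?b 1 * R)"
    then obtain e' where e': "e' \<in> Poly_Mapping.keys R" "?a + e = ?b + e'"
      using keys_mult[of "Poly_Mapping.single ?b 1" R] by auto
    then have "Poly_Mapping.lookup (?a + e) (VarX i) = Poly_Mapping.lookup (?b + e') (VarX i)"
      by simp
    then show False using max[OF e'(1)] assms(1) by (simp add: lookup_add lookup_single)
  qed
  moreover have "bracket i j = (Poly_Mapping.single ?a 1 - Poly_Mapping.single ?b 1 :: 'k mpoly)"
    by (simp add: bracket_def mvar_def mult_single)
  ultimately have "Poly_Mapping.lookup (bracket i j * R) (?a + e) = Poly_Mapping.lookup R e"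
    by (simp add: left_diff_distrib lookup_minus lookup_monomial_mult in_keys_iff)
  with assms(2) e show False by (simp add: in_keys_iff)
qed

text \<open>
  The bracket is the determinant of the matrix with columns \<open>(x\<^sub>i, y\<^sub>i)\<close> and \<open>(x\<^sub>j, y\<^sub>j)\<close>. By the
  hypothesis \<open>twist\<close> both columns are transformed by the same matrix, the transpose of the
  entrywise \<open>p ^ i\<close>-th power of \<open>A\<close>, and by additivity of this power its determinant is \<open>det A ^ (p ^ i)\<close>.
\<close>

lemma bracket_act:
  fixes A :: "'k::field^2^2"
  assumes frob: "\<And>x y :: 'k. (x + y) ^ (p ^ i) = x ^ (p ^ i) + y ^ (p ^ i)"
    and twist: "\<And>x :: 'k. x ^ (p ^ j) = x ^ (p ^ i)"
  shows "mpoly_subst (gl2_var p A) (bracket i j) = pm_scale (det A ^ (p ^ i)) (bracket i j)"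
proof -
  have diff: "(x - y) ^ (p ^ i) = x ^ (p ^ i) - y ^ (p ^ i)" for x y :: 'k
    using frob[of "x - y" y] by (simp add: algebra_simps)
  define C where "C x = (Poly_Mapping.single 0 x :: 'k mpoly)" for x
  have scale: "pm_scale x P = C x * P" for x :: 'k and P :: "'k mpoly"
    by (simp add: C_def pm_scale_def mult_map_scale_conv_mult)
  have C: "C (x * y) = C x * C y" "C (x - y) = C x - C y" for x y :: 'k
    by (simp_all add: C_def mult_single single_diff)
  show ?thesis
    unfolding bracket_def mpoly_subst_diff mpoly_subst_mult mpoly_subst_mvar gl2_var.simps twist
      det_2 diff power_mult_distrib scale C
    by (simp add: algebra_simps)
qed

lemma multihom_bracket:
  assumes "i < F" "j < F" "i \<noteq> j"
  shows "bracket i j \<in> multihom F ((\<lambda>_. 0)(i := 1, j := 1))"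
proof -
  have sum: "(\<lambda>t. of_bool (t = i) + of_bool (t = j)) = ((\<lambda>_. 0)(i := 1, j := 1) :: nat \<Rightarrow> int)"
    using assms(3) by auto
  have *: "mvar (VarX i) * mvar (VarY j) \<in> multihom F ((\<lambda>_. 0)(i := 1, j := 1))"
    "mvar (VarY i) * mvar (VarX j) \<in> multihom F ((\<lambda>_. 0)(i := 1, j := 1))"
    using multihom_mult[OF multihom_mvar(1)[OF assms(1)] multihom_mvar(2)[OF assms(2)]]
      multihom_mult[OF multihom_mvar(2)[OF assms(1)] multihom_mvar(1)[OF assms(2)]]
    by (simp_all only: sum)
  show ?thesis
    using multihom_add[OF *(1) multihom_scale[OF *(2), of "- 1"]] by (simp add: bracket_def)
qed

section \<open>Merging and polarization\<close>

definition merge :: "nat \<Rightarrow> nat \<Rightarrow> 'k::field mpoly \<Rightarrow> 'k mpoly" where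
  "merge i j = mpoly_subst
     (mvar(VarX j := mvar (VarX i), VarY j := mvar (VarY i)))"

lemma merge_bracket: "merge i j (bracket i j * R) = 0"
  by (simp add: merge_def mpoly_subst_mult bracket_def mpoly_subst_diff mult.commute)

definition degree_part :: "nat \<Rightarrow> nat \<Rightarrow> 'k::field mpoly \<Rightarrow> 'k mpoly" where
  "degree_part j b = pm_extend (\<lambda>e.
     if Poly_Mapping.lookup e (VarX j) + Poly_Mapping.lookup e (VarY j) = b
     then Poly_Mapping.single e 1 else 0)"

definition translate :: "nat \<Rightarrow> nat \<Rightarrow> 'k::field mpoly \<Rightarrow> 'k mpoly" where
  "translate i j = mpoly_subst
     (mvar(VarX i := mvar (VarX i) + mvar (VarX j), VarY i := mvar (VarY i) + mvar (VarY j)))"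

text \<open>
  For \<open>P\<close> free of the pair \<open>j\<close> this is the divided power \<open>D ^ b / b!\<close> of the derivation \<open>D\<close> that sends
  \<open>x\<^sub>i\<close> to \<open>x\<^sub>j\<close> and \<open>y\<^sub>i\<close> to \<open>y\<^sub>j\<close>, in a form that makes sense in every characteristic.
\<close>

definition polarize :: "nat \<Rightarrow> nat \<Rightarrow> nat \<Rightarrow> 'k::field mpoly \<Rightarrow> 'k mpoly" where
  "polarize i j b P = degree_part j b (translate i j P)"

lemma polarize_add: "polarize i j b (P + Q) = polarize i j b P + polarize i j b Q"
  and polarize_scale: "polarize i j b (pm_scale c P) = pm_scale c (polarize i j b P)"
  by (simp_all add: polarize_def degree_part_def translate_def mpoly_subst_add mpoly_subst_scale
      pm_extend_add pm_extend_scale)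

lemma degree_part_multihom:
  assumes "P \<in> multihom F k" "j < F"
  shows "degree_part j b P = (if k j = int b then P else 0)"
proof -
  have "degree_part j b P =
      pm_extend (\<lambda>e. if k j = int b then Poly_Mapping.single e 1 else 0) P"
    unfolding degree_part_def
  proof (rule pm_extend_cong)
    fix e assume "e \<in> Poly_Mapping.keys P"
    then have "int (Poly_Mapping.lookup e (VarX j) + Poly_Mapping.lookup e (VarY j)) = k j"
      using assms by (auto simp: multihom_def)
    then show "(if Poly_Mapping.lookup e (VarX j) + Poly_Mapping.lookup e (VarY j) = b
        then Poly_Mapping.single e 1 else 0) =
      (if k j = int b then Poly_Mapping.single e 1 else 0 :: 'a mpoly)" by auto
  qed
  then show ?thesis
    using pm_extend_basis[of P] by (simp add: pm_extend_def[of "\<lambda>_. 0"])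
qed

text \<open>
  A linear substitution within each pair of variables preserves the degree in every pair. For a
  single monomial this is the stability of \<open>multihom\<close> under the action, once the number of
  pairs is chosen large enough to contain all variables of the monomial.
\<close>

lemma degree_part_act:
  fixes P :: "'k::field mpoly"
  shows "degree_part j b (mpoly_subst (gl2_var p A) P) = mpoly_subst (gl2_var p A) (degree_part j b P)"
proof (rule pm_linear_ext[where
    g = "\<lambda>P. degree_part j b (mpoly_subst (gl2_var p A) P)" and
    h = "\<lambda>P. mpoly_subst (gl2_var p A) (degree_part j b P)"])
  fix e :: "xyvar \<Rightarrow>\<^sub>0 nat"
  \<comment> \<open>a number of pairs that covers the monomial and the index \<open>j\<close>\<close>
  obtain F where F: "\<forall>i \<in> insert j (var_index ` Poly_Mapping.keys e). i < F"
    by (metis finite_nat_set_iff_bounded finite_insert finite_imageI finite_keys)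
  let ?k = "\<lambda>i. int (Poly_Mapping.lookup e (VarX i) + Poly_Mapping.lookup e (VarY i))"
  have "e \<in> exponents F ?k"
    using F by (force simp: exponents_iff in_keys_iff)
  then have e: "Poly_Mapping.single e (1::'k) \<in> multihom F ?k" by (rule single_in_multihom)
  show "degree_part j b (mpoly_subst (gl2_var p A) (Poly_Mapping.single e 1)) =
    mpoly_subst (gl2_var p A) (degree_part j b (Poly_Mapping.single e 1))"
    using F degree_part_multihom[OF e, of j b] degree_part_multihom[OF multihom_act[OF e], of j b p A]
    by (simp split: if_splits)
qed (simp_all add: degree_part_def mpoly_subst_add mpoly_subst_scale pm_extend_add pm_extend_scale)

lemma translate_act:
  fixes A :: "'k::field^2^2"
  assumes twist: "\<And>x :: 'k. x ^ (p ^ j) = x ^ (p ^ i)"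
  shows "translate i j (mpoly_subst (gl2_var p A) P) = mpoly_subst (gl2_var p A) (translate i j P)"
proof -
  have "mpoly_subst (mvar(VarX i := mvar (VarX i) + mvar (VarX j), VarY i := mvar (VarY i) + mvar (VarY j)))
      (gl2_var p A z) = mpoly_subst (gl2_var p A)
      ((mvar(VarX i := mvar (VarX i) + mvar (VarX j), VarY i := mvar (VarY i) + mvar (VarY j))) z)" for z
    by (cases z) (simp_all add: mpoly_subst_add mpoly_subst_scale twist
        pm.scale_right_distrib algebra_simps)
  then show ?thesis unfolding translate_def mpoly_subst_compose by presburger
qed

lemma polarize_act:
  fixes A :: "'k::field^2^2"
  assumes twist: "\<And>x :: 'k. x ^ (p ^ j) = x ^ (p ^ i)"
  shows "polarize i j b (mpoly_subst (gl2_var p A) P) = mpoly_subst (gl2_var p A) (polarize i j b P)"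
  by (simp add: polarize_def translate_act[OF twist] degree_part_act)

text \<open>
  The exponent of \<open>x\<^sub>i ^ s * y\<^sub>i ^ t\<close> times the monomial of \<open>e\<close>, after \<open>u\<close> of the factors \<open>x\<^sub>i\<close> and \<open>v\<close> of the
  factors \<open>y\<^sub>i\<close> have been moved to the pair \<open>j\<close>.
\<close>

definition moved_exponent ::
    "nat \<Rightarrow> nat \<Rightarrow> (xyvar \<Rightarrow>\<^sub>0 nat) \<Rightarrow> nat \<Rightarrow> nat \<Rightarrow> nat \<Rightarrow> nat \<Rightarrow> (xyvar \<Rightarrow>\<^sub>0 nat)" where
  "moved_exponent i j e s t u v =
     e + Poly_Mapping.single (VarX i) (s - u) + Poly_Mapping.single (VarY i) (t - v)
       + Poly_Mapping.single (VarX j) u + Poly_Mapping.single (VarY j) v"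

lemma translate_monomial:
  fixes e :: "xyvar \<Rightarrow>\<^sub>0 nat" and i j s t :: nat
  assumes "Poly_Mapping.lookup e (VarX i) = 0" "Poly_Mapping.lookup e (VarY i) = 0"
  shows "translate i j (Poly_Mapping.single
      (e + Poly_Mapping.single (VarX i) s + Poly_Mapping.single (VarY i) t) (1::'k::field)) =
    (\<Sum>u\<le>s. \<Sum>v\<le>t. Poly_Mapping.single (moved_exponent i j e s t u v) (of_nat ((s choose u) * (t choose v))))"
proof -
  let ?\<sigma> = "mvar(VarX i := mvar (VarX i) + mvar (VarX j), VarY i := mvar (VarY i) + mvar (VarY j))
    :: xyvar \<Rightarrow> 'k mpoly"
  have binomial: "(mvar z + mvar z' :: 'k mpoly) ^ n = (\<Sum>u\<le>n. Poly_Mapping.single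
      (Poly_Mapping.single z (n - u) + Poly_Mapping.single z' u) (of_nat (n choose u)))"
    for z z' n
    by (subst add.commute, subst binomial_ring)
      (simp add: mvar_power mult_single single_of_nat[symmetric] add.commute del: single_of_nat)
  have "mpoly_mon ?\<sigma> e = Poly_Mapping.single e 1"
    using assms by (subst mpoly_mon_cong[of e ?\<sigma> mvar]) (auto simp: in_keys_iff)
  then show ?thesis
    by (simp add: translate_def mpoly_mon_add binomial sum_product mult.assoc)
      (simp add: sum_distrib_left mult_single moved_exponent_def add_ac)
qed

lemma exponent_split:
  obtains e' where "e = e' + Poly_Mapping.single (VarX i) (Poly_Mapping.lookup e (VarX i))
      + Poly_Mapping.single (VarY i) (Poly_Mapping.lookup e (VarY i))"
    and "Poly_Mapping.lookup e' (VarX i) = 0" "Poly_Mapping.lookup e' (VarY i) = (0::nat)"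
proof
  let ?e = "e - (Poly_Mapping.single (VarX i) (Poly_Mapping.lookup e (VarX i))
      + Poly_Mapping.single (VarY i) (Poly_Mapping.lookup e (VarY i)))"
  show "e = ?e + Poly_Mapping.single (VarX i) (Poly_Mapping.lookup e (VarX i))
      + Poly_Mapping.single (VarY i) (Poly_Mapping.lookup e (VarY i))"
    by (rule poly_mapping_eqI) (auto simp: lookup_add lookup_minus lookup_single when_def)
  show "Poly_Mapping.lookup ?e (VarX i) = 0" "Poly_Mapping.lookup ?e (VarY i) = 0"
    by (simp_all add: lookup_add lookup_minus lookup_single when_def)
qed

lemma polarize_monomial:
  fixes e :: "xyvar \<Rightarrow>\<^sub>0 nat" and i j s t b :: nat
  assumes "i \<noteq> j"
    and "Poly_Mapping.lookup e (VarX i) = 0" "Poly_Mapping.lookup e (VarY i) = 0"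
    and "Poly_Mapping.lookup e (VarX j) = 0" "Poly_Mapping.lookup e (VarY j) = 0"
  shows "polarize i j b (Poly_Mapping.single
      (e + Poly_Mapping.single (VarX i) s + Poly_Mapping.single (VarY i) t) (1::'k::field)) =
    (\<Sum>u\<le>s. \<Sum>v\<le>t. if u + v = b
      then Poly_Mapping.single (moved_exponent i j e s t u v) (of_nat ((s choose u) * (t choose v))) else 0)"
proof -
  have deg: "Poly_Mapping.lookup (moved_exponent i j e s t u v) (VarX j) = u" "Poly_Mapping.lookup (moved_exponent i j e s t u v) (VarY j) = v"
    for u v
    using assms by (simp_all add: moved_exponent_def lookup_add lookup_single)
  show ?thesis
    unfolding polarize_def translate_monomial[OF assms(2,3)] degree_part_def
      pm_extend_sum pm_extend_single deg
    by (intro sum.cong refl) simp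
qed

text \<open>
  Vandermonde's identity in the shape produced by polarizing a monomial: the range of both
  indices is cut off by the exponents rather than by \<open>b\<close>.
\<close>

lemma vandermonde_square:
  "(\<Sum>u\<le>s. \<Sum>v\<le>t. if u + v = b then (s choose u) * (t choose v) else 0) = (s + t) choose b"
proof -
  have "(\<Sum>v\<le>t. if u + v = b then (s choose u) * (t choose v) else 0) =
    (if u \<le> b then (s choose u) * (t choose (b - u)) else 0)" for u
  proof (cases "u \<le> b")
    case True
    then have "(\<Sum>v\<le>t. if u + v = b then (s choose u) * (t choose v) else 0) =
      (\<Sum>v\<le>t. if v = b - u then (s choose u) * (t choose v) else 0)"
      by (intro sum.cong) auto
    then show ?thesis using True by (simp add: binomial_eq_0)
  qed (auto intro: sum.neutral)
  then have "(\<Sum>u\<le>s. \<Sum>v\<le>t. if u + v = b then (s choose u) * (t choose v) else 0) =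
    (\<Sum>u\<le>s. if u \<le> b then (s choose u) * (t choose (b - u)) else 0)" by simp
  also have "\<dots> = (\<Sum>u\<le>b. (s choose u) * (t choose (b - u)))"
  proof -
    have "(\<Sum>u\<le>s. if u \<le> b then (s choose u) * (t choose (b - u)) else 0) =
      (\<Sum>u\<in>{..s} \<inter> {..b}. (s choose u) * (t choose (b - u)))"
      by (subst sum.inter_restrict) auto
    also have "\<dots> = (\<Sum>u\<le>b. (s choose u) * (t choose (b - u)))"
      by (rule sum.mono_neutral_left) (auto simp: binomial_eq_0)
    finally show ?thesis .
  qed
  finally show ?thesis by (simp add: vandermonde)
qed

text \<open>
  Merging undoes the moves of a polarized monomial, so each of them returns the monomial itself,
  with the coefficient \<open>(s choose u) * (t choose v)\<close> where \<open>u + v = b\<close>. These add up to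
  \<open>(s + t) choose b\<close>, which depends only on the degree.
\<close>

lemma merge_polarize:
  fixes Q :: "'k::field mpoly"
  assumes "i \<noteq> j" "i < F" "j < F" "Q \<in> multihom F k" "k i = int d" "k j = 0"
  shows "merge i j (polarize i j b Q) = pm_scale (of_nat (d choose b)) Q"
proof (rule pm_linear_ext[where g = "\<lambda>Q. merge i j (polarize i j b Q)"
      and h = "pm_scale (of_nat (d choose b))"])
  fix e assume "e \<in> Poly_Mapping.keys Q"
  then have e: "e \<in> exponents F k" using assms(4) by (auto simp: multihom_eq)
  then have j: "Poly_Mapping.lookup e (VarX j) = 0" "Poly_Mapping.lookup e (VarY j) = 0"
    using assms by (force simp: exponents_iff)+
  define s t where "s = Poly_Mapping.lookup e (VarX i)" and "t = Poly_Mapping.lookup e (VarY i)"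
  have st: "s + t = d" using e assms by (auto simp: exponents_iff s_def t_def)
  obtain e' where e': "e = e' + Poly_Mapping.single (VarX i) s + Poly_Mapping.single (VarY i) t"
    "Poly_Mapping.lookup e' (VarX i) = 0" "Poly_Mapping.lookup e' (VarY i) = 0"
    unfolding s_def t_def by (rule exponent_split)
  have j': "Poly_Mapping.lookup e' (VarX j) = 0" "Poly_Mapping.lookup e' (VarY j) = 0"
    using j by (simp_all add: e'(1) lookup_add)
  let ?\<tau> = "mvar(VarX j := mvar (VarX i), VarY j := mvar (VarY i)) :: xyvar \<Rightarrow> 'k mpoly"
  have "mpoly_mon ?\<tau> e' = Poly_Mapping.single e' 1"
    using j' by (subst mpoly_mon_cong[of e' ?\<tau> mvar]) (auto simp: in_keys_iff)
  then have mono: "mpoly_mon ?\<tau> (moved_exponent i j e' s t u v) = Poly_Mapping.single e 1" if "u \<le> s" "v \<le> t" for u v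
  proof -
    have "mpoly_mon ?\<tau> (moved_exponent i j e' s t u v) = Poly_Mapping.single
        (e' + Poly_Mapping.single (VarX i) (s - u) + Poly_Mapping.single (VarY i) (t - v)
          + Poly_Mapping.single (VarX i) u + Poly_Mapping.single (VarY i) v) 1"
      using \<open>mpoly_mon ?\<tau> e' = _\<close> assms(1)
      by (simp add: moved_exponent_def mpoly_mon_add mvar_power mult_single)
    also have "e' + Poly_Mapping.single (VarX i) (s - u) + Poly_Mapping.single (VarY i) (t - v)
          + Poly_Mapping.single (VarX i) u + Poly_Mapping.single (VarY i) v = e"
      unfolding e'(1) using that
      by (intro poly_mapping_eqI) (auto simp: lookup_add lookup_single when_def)
    finally show ?thesis .
  qed
  have "merge i j (polarize i j b (Poly_Mapping.single e (1::'k))) =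
    (\<Sum>u\<le>s. \<Sum>v\<le>t. Poly_Mapping.single e
        (of_nat (if u + v = b then (s choose u) * (t choose v) else 0)))"
    unfolding e'(1) polarize_monomial[OF assms(1) e'(2,3) j'] merge_def mpoly_subst_sum
    by (intro sum.cong refl) (simp add: mono mpoly_subst_eq e'(1)[symmetric])
  also have "\<dots> = Poly_Mapping.single e (of_nat
      (\<Sum>u\<le>s. \<Sum>v\<le>t. if u + v = b then (s choose u) * (t choose v) else 0))"
    by (rule poly_mapping_eqI) (simp add: lookup_sum lookup_single when_def)
  finally show "merge i j (polarize i j b (Poly_Mapping.single e (1::'k))) =
      pm_scale (of_nat (d choose b)) (Poly_Mapping.single e 1)"
    by (simp add: vandermonde_square st)
qed (simp_all add: polarize_add polarize_scale merge_def mpoly_subst_add mpoly_subst_scale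
  pm.scale_right_distrib mult.commute)

lemma multihom_polarize:
  fixes Q :: "'k::field mpoly"
  assumes "i \<noteq> j" "i < F" "j < F" "Q \<in> multihom F k" "k i = int (a + b)" "k j = 0"
  shows "polarize i j b Q \<in> multihom F (k(i := int a, j := int b))"
proof -
  have mono: "polarize i j b (Poly_Mapping.single e (1::'k)) \<in> multihom F (k(i := int a, j := int b))"
    if "e \<in> Poly_Mapping.keys Q" for e
  proof -
    have e: "e \<in> exponents F k" using assms(4) that by (auto simp: multihom_eq)
    then have j: "Poly_Mapping.lookup e (VarX j) = 0" "Poly_Mapping.lookup e (VarY j) = 0"
      using assms by (force simp: exponents_iff)+
    define s t where "s = Poly_Mapping.lookup e (VarX i)" and "t = Poly_Mapping.lookup e (VarY i)"
    have st: "s + t = a + b" using e assms by (auto simp: exponents_iff s_def t_def)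
    obtain e' where e': "e = e' + Poly_Mapping.single (VarX i) s + Poly_Mapping.single (VarY i) t"
      "Poly_Mapping.lookup e' (VarX i) = 0" "Poly_Mapping.lookup e' (VarY i) = 0"
      unfolding s_def t_def by (rule exponent_split)
    have j': "Poly_Mapping.lookup e' (VarX j) = 0" "Poly_Mapping.lookup e' (VarY j) = 0"
      using j by (simp_all add: e'(1) lookup_add)
    have "moved_exponent i j e' s t u v \<in> exponents F (k(i := int a, j := int b))"
      if "u \<le> s" "v \<le> t" "u + v = b" for u v
      using e e'(2,3) j' assms(1-3) st that unfolding exponents_iff
      by (auto simp: e'(1) moved_exponent_def lookup_add lookup_single when_def split: if_splits)
    then show ?thesis
      unfolding e'(1) polarize_monomial[OF assms(1) e'(2,3) j']
      by (intro multihom_sum) (auto intro: multihom_0 single_in_multihom)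
  qed
  interpret lin: module_hom pm_scale pm_scale "polarize i j b"
    by unfold_locales (simp_all add: polarize_add polarize_scale)
  have "polarize i j b Q = polarize i j b
      (\<Sum>e\<in>Poly_Mapping.keys Q. pm_scale (Poly_Mapping.lookup Q e) (Poly_Mapping.single e 1))"
    by (subst mpoly_expand[of Q]) simp
  then show ?thesis
    using mono by (simp only: lin.sum lin.scale) (intro multihom_sum multihom_scale)
qed

text \<open>
  Merging separates the two contributions: it annihilates multiples of the bracket and recovers
  \<open>Q\<close> from its polarization up to a nonzero factor.
\<close>

lemma polarize_bracket_independent:
  fixes Q R :: "'k::field mpoly"
  assumes "i \<noteq> j" "i < F" "j < F" "Q \<in> multihom F k" "k i = int d" "k j = 0"
    and "of_nat (d choose b) \<noteq> (0::'k)"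
    and zero: "polarize i j b Q + bracket i j * R = 0"
  shows "Q = 0" "R = 0"
proof -
  have "merge i j (polarize i j b Q + bracket i j * R) = pm_scale (of_nat (d choose b)) Q"
    using merge_polarize[OF assms(1-6)] merge_bracket[of i j R]
    by (simp add: merge_def mpoly_subst_add)
  then have "pm_scale (of_nat (d choose b)) Q = 0"
    by (simp add: zero merge_def)
  then show "Q = 0" using assms(7) by (simp add: pm.scale_eq_0_iff)
  then have "bracket i j * R = 0"
    using zero by (simp add: polarize_def translate_def degree_part_def)
  then show "R = 0" by (rule bracket_mult_eq_0[OF assms(1)])
qed

section \<open>Decomposing a space of bihomogeneous polynomials\<close>

text \<open>
  The degrees in the \<open>f + f\<close> pairs of variables when the splitting has been carried out for the
  indices below \<open>j\<close>: index \<open>i\<close> then has bidegree \<open>(m i + n i, 0)\<close> or \<open>(m i - 1, n i - 1)\<close>, and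
  \<open>(m i, n i)\<close> before. The formulas are those of the direct summands.
\<close>

definition split_degree :: "nat \<Rightarrow> (nat \<Rightarrow> nat) \<Rightarrow> (nat \<Rightarrow> nat) \<Rightarrow> nat \<Rightarrow> (nat \<Rightarrow> nat) \<Rightarrow> nat \<Rightarrow> int" where
  "split_degree f m n j l t =
    (if t < f
     then if t < j then int (m t) - int (l t) + (1 - int (l t)) * int (n t) else int (m t)
     else if t - f < j then int (l (t - f)) * int (n (t - f)) - int (l (t - f)) else int (n (t - f)))"

text \<open>
  The embedding of the summand of \<open>l\<close> after splitting the indices below \<open>j\<close>. The map for the last
  index is applied first, so that the induction on \<open>j\<close> refines each summand found so far.
\<close>

primrec embed_summand :: "nat \<Rightarrow> (nat \<Rightarrow> nat) \<Rightarrow> nat \<Rightarrow> (nat \<Rightarrow> nat) \<Rightarrow> 'k::field mpoly \<Rightarrow> 'k mpoly" where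
  "embed_summand f n 0 l P = P"
| "embed_summand f n (Suc j) l P = embed_summand f n j l
    (if l j = 0 then polarize j (f + j) (n j) P else bracket j (f + j) * P)"

lemma embed_summand_add: "embed_summand f n j l (P + Q) = embed_summand f n j l P + embed_summand f n j l Q"
  by (induction j arbitrary: P Q) (simp_all add: polarize_add distrib_left)

lemma embed_summand_scale: "embed_summand f n j l (pm_scale c P) = pm_scale c (embed_summand f n j l P)"
  by (induction j arbitrary: P) (simp_all add: polarize_scale pm_scale_mult_right)

lemma embed_summand_cong:
  "(\<And>i. i < j \<Longrightarrow> l i = l' i) \<Longrightarrow> embed_summand f n j l P = embed_summand f n j l' P"
  by (induction j arbitrary: P) simp_all

lemma split_degree_cong:
  "(\<And>i. i < j \<Longrightarrow> l i = l' i) \<Longrightarrow> split_degree f m n j l = split_degree f m n j l'"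
  by (auto simp: split_degree_def fun_eq_iff)

lemma multihom_split_step:
  fixes P :: "'k::field mpoly"
  assumes "j < f" "l j \<in> {0, 1}" "P \<in> multihom (f + f) (split_degree f m n (Suc j) l)"
  shows "(if l j = 0 then polarize j (f + j) (n j) P else bracket j (f + j) * P)
    \<in> multihom (f + f) (split_degree f m n j l)"
proof (cases "l j = 0")
  case True
  have "(split_degree f m n (Suc j) l)(j := int (m j), f + j := int (n j)) = split_degree f m n j l"
    using assms(1) by (auto simp: split_degree_def fun_eq_iff less_Suc_eq)
  moreover have "polarize j (f + j) (n j) P \<in> multihom (f + f)
      ((split_degree f m n (Suc j) l)(j := int (m j), f + j := int (n j)))"
    using assms True by (intro multihom_polarize) (auto simp: split_degree_def)
  ultimately show ?thesis using True by simp
next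
  case False
  with assms(2) have l: "l j = 1" by simp
  have "(\<lambda>t. ((\<lambda>_. 0)(j := 1, f + j := 1)) t + split_degree f m n (Suc j) l t) = split_degree f m n j l"
    using assms(1) l by (auto simp: split_degree_def fun_eq_iff less_Suc_eq)
  with multihom_mult[OF multihom_bracket[of j "f + f" "f + j"] assms(3)] show ?thesis
    using assms(1) l by simp
qed

lemma multihom_embed_summand:
  assumes "j \<le> f" "\<And>i. i < j \<Longrightarrow> l i \<in> {0, 1}" "P \<in> multihom (f + f) (split_degree f m n j l)"
  shows "embed_summand f n j l P \<in> multihom (f + f) (split_degree f m n 0 l)"
  using assms
proof (induction j arbitrary: P)
  case (Suc j)
  then show ?case
    using multihom_split_step[of j f l P m n] by simp
qed simp

text \<open>
  Polarization commutes with the action and the bracket of index \<open>i\<close> contributes the factor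
  \<open>det A ^ (p ^ i)\<close>. The exponents of the indices with \<open>l i = 1\<close> add up to \<open>psi p j l\<close>.
\<close>

lemma embed_summand_act:
  fixes A :: "'k::field^2^2"
  assumes frob: "\<And>(x :: 'k) y i. (x + y) ^ (p ^ i) = x ^ (p ^ i) + y ^ (p ^ i)"
    and twist: "\<And>(x :: 'k) i. x ^ (p ^ (f + i)) = x ^ (p ^ i)"
    and "\<And>i. i < j \<Longrightarrow> l i \<in> {0, 1}"
  shows "mpoly_subst (gl2_var p A) (embed_summand f n j l P) =
    pm_scale (det A ^ psi p j l) (embed_summand f n j l (mpoly_subst (gl2_var p A) P))"
  using assms(3)
proof (induction j arbitrary: P)
  case (Suc j)
  have IH: "mpoly_subst (gl2_var p A) (embed_summand f n j l P) =
    pm_scale (det A ^ psi p j l) (embed_summand f n j l (mpoly_subst (gl2_var p A) P))" for P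
    by (rule Suc) (use Suc(2) in auto)
  show ?case
  proof (cases "l j = 0")
    case True
    then show ?thesis by (simp add: IH polarize_act[OF twist] psi_def)
  next
    case False
    with Suc(2)[of j] have "l j = 1" by simp
    then show ?thesis
      by (simp add: IH mpoly_subst_mult bracket_act[OF frob twist] pm_scale_mult_left embed_summand_scale
          psi_def power_add)
  qed
qed (simp add: psi_def)

lemma sum_PiE_Suc:
  fixes g :: "(nat \<Rightarrow> nat) \<Rightarrow> 'a::comm_monoid_add"
  shows "(\<Sum>l\<in>{..<Suc j} \<rightarrow>\<^sub>E {0, 1}. g l) = (\<Sum>l\<in>{..<j} \<rightarrow>\<^sub>E {0, 1}. g (l(j := 0)) + g (l(j := 1)))"
proof -
  have "({..<Suc j} \<rightarrow>\<^sub>E {0, 1}) = (\<lambda>(c, l). l(j := c)) ` ({0, 1::nat} \<times> ({..<j} \<rightarrow>\<^sub>E {0, 1}))"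
    by (simp add: lessThan_Suc PiE_insert_eq)
  moreover have "inj_on (\<lambda>(c, l). l(j := c)) ({0, 1::nat} \<times> ({..<j} \<rightarrow>\<^sub>E {0, 1}))"
    by (rule inj_combinator) simp
  ultimately have "(\<Sum>l\<in>{..<Suc j} \<rightarrow>\<^sub>E {0, 1}. g l) =
      (\<Sum>(c, l)\<in>{0, 1::nat} \<times> ({..<j} \<rightarrow>\<^sub>E {0, 1}). g (l(j := c)))"
    by (simp add: sum.reindex case_prod_unfold)
  also have "\<dots> = (\<Sum>c\<in>{0, 1::nat}. \<Sum>l\<in>{..<j} \<rightarrow>\<^sub>E {0, 1}. g (l(j := c)))"
    by (simp add: sum.cartesian_product)
  finally show ?thesis by (simp add: sum.distrib)
qed

text \<open>
  The summands at stage \<open>j + 1\<close> that extend the same choice below \<open>j\<close> sum to one element of a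
  summand at stage \<open>j\<close>. By induction this element is zero, and then so are its two components.
\<close>

lemma embed_summand_independent:
  fixes x :: "(nat \<Rightarrow> nat) \<Rightarrow> 'k::field mpoly"
  assumes binomial: "\<And>i. i < f \<Longrightarrow> of_nat ((m i + n i) choose n i) \<noteq> (0::'k)"
    and "j \<le> f"
    and "\<And>l. l \<in> {..<j} \<rightarrow>\<^sub>E {0, 1} \<Longrightarrow> x l \<in> multihom (f + f) (split_degree f m n j l)"
    and "(\<Sum>l\<in>{..<j} \<rightarrow>\<^sub>E {0, 1}. embed_summand f n j l (x l)) = 0"
    and "l \<in> {..<j} \<rightarrow>\<^sub>E {0, 1}"
  shows "x l = 0"
  using assms(2-)
proof (induction j arbitrary: x l)
  case 0
  then show ?case by simp
next
  case (Suc j)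
  \<comment> \<open>the two components above \<open>l\<close>, combined into one element of the summand of \<open>l\<close> at stage \<open>j\<close>\<close>
  define y where "y l = polarize j (f + j) (n j) (x (l(j := 0))) + bracket j (f + j) * x (l(j := 1))"
    for l
  have upd: "l(j := c) \<in> {..<Suc j} \<rightarrow>\<^sub>E {0, 1}" if "l \<in> {..<j} \<rightarrow>\<^sub>E {0, 1}" "c \<in> {0, 1}"
    for l :: "nat \<Rightarrow> nat" and c
    using that by (auto simp: PiE_iff extensional_def less_Suc_eq)
  have x: "x (l(j := c)) \<in> multihom (f + f) (split_degree f m n (Suc j) (l(j := c)))"
    if "l \<in> {..<j} \<rightarrow>\<^sub>E {0, 1}" "c \<in> {0, 1}" for l c
    using Suc.prems(2)[OF upd[OF that]] .
  have deg: "split_degree f m n j (l(j := c)) = split_degree f m n j l" for l c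
    by (rule split_degree_cong) simp
  have y: "y l \<in> multihom (f + f) (split_degree f m n j l)" if "l \<in> {..<j} \<rightarrow>\<^sub>E {0, 1}" for l
    using multihom_split_step[OF _ _ x[OF that, of 0]] multihom_split_step[OF _ _ x[OF that, of 1]]
      Suc.prems(1) by (auto simp: y_def deg intro!: multihom_add)
  have upd_cong: "embed_summand f n j (l(j := c)) P = embed_summand f n j l P" for l c and P :: "'k mpoly"
    by (rule embed_summand_cong) simp
  have "embed_summand f n (Suc j) (l(j := 0)) (x (l(j := 0))) + embed_summand f n (Suc j) (l(j := 1)) (x (l(j := 1)))
      = embed_summand f n j l (y l)" for l
    using upd_cong by (simp add: y_def embed_summand_add)
  then have "(\<Sum>l\<in>{..<j} \<rightarrow>\<^sub>E {0, 1}. embed_summand f n j l (y l)) = 0"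
    using Suc.prems(3) by (simp only: sum_PiE_Suc)
  then have y0: "y l = 0" if "l \<in> {..<j} \<rightarrow>\<^sub>E {0, 1}" for l
    using Suc.IH[of y l] y that Suc.prems(1) by simp
  let ?l = "restrict l {..<j}"
  have l': "?l \<in> {..<j} \<rightarrow>\<^sub>E {0, 1}" and l: "l = ?l(j := l j)" and "l j \<in> {0, 1}"
    using Suc.prems(4) by (auto simp: PiE_iff extensional_def fun_eq_iff less_Suc_eq)
  have "polarize j (f + j) (n j) (x (?l(j := 0))) + bracket j (f + j) * x (?l(j := 1)) = 0"
    using y0[OF l'] by (simp add: y_def)
  note independent = polarize_bracket_independent[OF _ _ _ x[OF l'] _ _ _ this, where d = "m j + n j"]
  have "x (?l(j := 0)) = 0"
    by (rule independent(1)) (use Suc.prems(1) binomial[of j] in \<open>auto simp: split_degree_def\<close>)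
  moreover have "x (?l(j := 1)) = 0"
    by (rule independent(2)) (use Suc.prems(1) binomial[of j] in \<open>auto simp: split_degree_def\<close>)
  ultimately show ?case using l \<open>l j \<in> {0, 1}\<close> by (metis insertE singletonD)
qed

lemma prod_lessThan_add:
  fixes f g :: nat
  shows "(\<Prod>t<f + g. h t) = (\<Prod>t<f. h t) * (\<Prod>t<g. h (f + t) :: 'a::comm_monoid_mult)"
  by (induction g) (simp_all add: mult_ac)

text \<open>
  Both sides count monomials. Index \<open>i\<close> contributes \<open>(m i + n i + 1) * 1\<close> for \<open>l i = 0\<close> and \<open>m i * n i\<close>
  for \<open>l i = 1\<close>, with sum \<open>(m i + 1) * (n i + 1)\<close>, and the product over \<open>i\<close> of these sums expands
  into the sum over \<open>l\<close>.
\<close>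

lemma card_split_degree:
  "(\<Sum>l\<in>{..<f} \<rightarrow>\<^sub>E {0, 1}. \<Prod>t<f + f. nat (split_degree f m n f l t + 1)) =
    (\<Prod>t<f + f. nat (split_degree f m n 0 l' t + 1))"
proof -
  let ?g = "\<lambda>i (c::nat). if c = 0 then m i + n i + 1 else m i * n i"
  have "(\<Prod>t<f + f. nat (split_degree f m n f l t + 1)) = (\<Prod>i<f. ?g i (l i))"
    if l: "l \<in> {..<f} \<rightarrow>\<^sub>E {0, 1}" for l
    unfolding prod_lessThan_add prod.distrib[symmetric]
  proof (rule prod.cong[OF refl])
    fix i assume "i \<in> {..<f}"
    moreover from this have "l i \<in> {0, 1}" using l by blast
    ultimately show "nat (split_degree f m n f l i + 1) * nat (split_degree f m n f l (f + i) + 1) = ?g i (l i)"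
      by (auto simp: split_degree_def nat_add_distrib)
  qed
  then have "(\<Sum>l\<in>{..<f} \<rightarrow>\<^sub>E {0, 1}. \<Prod>t<f + f. nat (split_degree f m n f l t + 1)) =
      (\<Sum>l\<in>{..<f} \<rightarrow>\<^sub>E {0, 1}. \<Prod>i<f. ?g i (l i))" by simp
  also have "\<dots> = (\<Prod>i<f. \<Sum>c\<in>{0, 1}. ?g i c)"
    by (rule prod_sum_PiE[symmetric]) auto
  also have "\<dots> = (\<Prod>t<f + f. nat (split_degree f m n 0 l' t + 1))"
    unfolding prod_lessThan_add prod.distrib[symmetric]
    by (rule prod.cong) (auto simp: split_degree_def nat_add_distrib algebra_simps)
  finally show ?thesis .
qed

text \<open>
  Independence of the summands gives injectivity, and an injective map between finite sets of
  the same size is onto.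
\<close>

lemma bij_sum_embed_summand:
  assumes binomial: "\<And>i. i < f \<Longrightarrow> of_nat ((m i + n i) choose n i) \<noteq> (0::'k::{field,finite})"
  shows "bij_betw (\<lambda>x :: (nat \<Rightarrow> nat) \<Rightarrow> 'k mpoly. \<Sum>l\<in>{..<f} \<rightarrow>\<^sub>E {0, 1}. embed_summand f n f l (x l))
    (\<Pi>\<^sub>E l\<in>{..<f} \<rightarrow>\<^sub>E {0, 1}. multihom (f + f) (split_degree f m n f l))
    (multihom (f + f) (split_degree f m n 0 l'))"
    (is "bij_betw ?\<Phi> ?X ?U")
proof -
  let ?I = "{..<f} \<rightarrow>\<^sub>E {0, 1::nat}"
  have fin: "finite ?I" by (intro finite_PiE) auto
  have inj: "inj_on ?\<Phi> ?X"
  proof (rule inj_onI)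
    fix x y assume xy: "x \<in> ?X" "y \<in> ?X" "?\<Phi> x = ?\<Phi> y"
    have diff: "x l - y l \<in> multihom (f + f) (split_degree f m n f l)" if "l \<in> ?I" for l
      using xy(1,2) that by (intro multihom_diff) (auto dest: PiE_mem)
    have zero: "?\<Phi> (\<lambda>l. x l - y l) = 0"
    proof -
      have "embed_summand f n f l (x l - y l) = embed_summand f n f l (x l) - embed_summand f n f l (y l)" for l
        using embed_summand_add[of f n f l "x l - y l" "y l"] by (simp add: algebra_simps)
      then show ?thesis using xy(3) by (simp add: sum_subtractf)
    qed
    have "x l - y l = 0" if "l \<in> ?I" for l
      by (rule embed_summand_independent[where x = "\<lambda>l. x l - y l", OF binomial le_refl diff zero that])
    then show "x = y" using xy by (intro PiE_ext) auto
  qed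
  have deg0: "split_degree f m n 0 l = split_degree f m n 0 l'" for l
    by (rule split_degree_cong) simp
  have "?\<Phi> ` ?X \<subseteq> ?U"
  proof (intro image_subsetI multihom_sum)
    fix x l assume "x \<in> ?X" "l \<in> ?I"
    then show "embed_summand f n f l (x l) \<in> ?U"
      using multihom_embed_summand[of f f l "x l" m n] deg0[of l] by (auto simp: PiE_iff)
  qed
  moreover have "card ?X = card ?U"
    using card_split_degree[of f m n l'] fin
    by (simp add: card_PiE card_multihom power_sum[symmetric])
  ultimately have "?\<Phi> ` ?X = ?U"
    using inj by (intro card_subset_eq) (simp_all add: card_multihom card_image)
  with inj show ?thesis by (simp add: bij_betw_def)
qed

section \<open>Linear maps out of a tensor product\<close>

lemma tensor_relations_add_left:
  "v \<in> carrier V \<Longrightarrow> v' \<in> carrier V \<Longrightarrow> w \<in> carrier W \<Longrightarrow>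
    Poly_Mapping.single (v \<oplus>\<^bsub>V\<^esub> v', w) 1 - Poly_Mapping.single (v, w) 1 - Poly_Mapping.single (v', w) 1
      \<in> tensor_relations V W"
  unfolding tensor_relations_def by (rule pm.span_base) blast

lemma tensor_relations_add_right:
  "v \<in> carrier V \<Longrightarrow> w \<in> carrier W \<Longrightarrow> w' \<in> carrier W \<Longrightarrow>
    Poly_Mapping.single (v, w \<oplus>\<^bsub>W\<^esub> w') 1 - Poly_Mapping.single (v, w) 1 - Poly_Mapping.single (v, w') 1
      \<in> tensor_relations V W"
  unfolding tensor_relations_def by (rule pm.span_base) blast

lemma tensor_relations_smult_left:
  "v \<in> carrier V \<Longrightarrow> w \<in> carrier W \<Longrightarrow>
    Poly_Mapping.single (c \<odot>\<^bsub>V\<^esub> v, w) 1 - pm_scale c (Poly_Mapping.single (v, w) 1)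
      \<in> tensor_relations V W"
  unfolding tensor_relations_def by (rule pm.span_base) blast

lemma tensor_relations_smult_right:
  "v \<in> carrier V \<Longrightarrow> w \<in> carrier W \<Longrightarrow>
    Poly_Mapping.single (v, c \<odot>\<^bsub>W\<^esub> w) 1 - pm_scale c (Poly_Mapping.single (v, w) 1)
      \<in> tensor_relations V W"
  unfolding tensor_relations_def by (rule pm.span_base) blast

text \<open>
  The linear map that a bilinear \<open>\<beta>\<close> induces on cosets, computed on an arbitrary representative.
\<close>

definition tensor_lift :: "('v \<Rightarrow> 'w \<Rightarrow> ('b \<Rightarrow>\<^sub>0 'k::field)) \<Rightarrow> ('v \<times> 'w \<Rightarrow>\<^sub>0 'k) set \<Rightarrow> ('b \<Rightarrow>\<^sub>0 'k)" where
  "tensor_lift \<beta> T = pm_extend (case_prod \<beta>) (SOME F. F \<in> T)"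

locale bilinear_map =
  fixes V :: "('g, 'k::field, 'v) rep" and W :: "('g, 'k, 'w) rep"
    and \<beta> :: "'v \<Rightarrow> 'w \<Rightarrow> ('b \<Rightarrow>\<^sub>0 'k)"
  assumes add_left: "v \<in> carrier V \<Longrightarrow> v' \<in> carrier V \<Longrightarrow> w \<in> carrier W \<Longrightarrow>
      \<beta> (v \<oplus>\<^bsub>V\<^esub> v') w = \<beta> v w + \<beta> v' w"
    and add_right: "v \<in> carrier V \<Longrightarrow> w \<in> carrier W \<Longrightarrow> w' \<in> carrier W \<Longrightarrow>
      \<beta> v (w \<oplus>\<^bsub>W\<^esub> w') = \<beta> v w + \<beta> v w'"
    and smult_left: "v \<in> carrier V \<Longrightarrow> w \<in> carrier W \<Longrightarrow>
      \<beta> (c \<odot>\<^bsub>V\<^esub> v) w = pm_scale c (\<beta> v w)"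
    and smult_right: "v \<in> carrier V \<Longrightarrow> w \<in> carrier W \<Longrightarrow>
      \<beta> v (c \<odot>\<^bsub>W\<^esub> w) = pm_scale c (\<beta> v w)"
begin

lemma extend_relation_eq_0:
  assumes "r \<in> tensor_relations V W"
  shows "pm_extend (case_prod \<beta>) r = 0"
proof -
  interpret lin: module_hom pm_scale pm_scale "pm_extend (case_prod \<beta>)" by (rule pm_extend_linear)
  have "tensor_relations V W \<subseteq> {r. pm_extend (case_prod \<beta>) r = 0}"
    unfolding tensor_relations_def
    by (rule pm.span_minimal[OF _ lin.subspace_kernel])
      (auto simp: pm_extend_diff add_left add_right smult_left smult_right)
  with assms show ?thesis by blast
qed

lemma lift_class: "tensor_lift \<beta> (tensor_class V W F) = pm_extend (case_prod \<beta>) F"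
proof -
  have "(SOME H. H \<in> tensor_class V W F) \<in> tensor_class V W F"
    by (rule someI[of "\<lambda>H. H \<in> tensor_class V W F"]) (rule mem_tensor_class_self)
  then have "(SOME H. H \<in> tensor_class V W F) - F \<in> tensor_relations V W"
    by (simp add: mem_tensor_class)
  from extend_relation_eq_0[OF this] show ?thesis
    by (simp add: tensor_lift_def pm_extend_diff)
qed

lemma lift_add:
  "T \<in> carrier (V \<otimes>\<^sub>r W) \<Longrightarrow> T' \<in> carrier (V \<otimes>\<^sub>r W) \<Longrightarrow>
    tensor_lift \<beta> (T \<oplus>\<^bsub>V \<otimes>\<^sub>r W\<^esub> T') = tensor_lift \<beta> T + tensor_lift \<beta> T'"
  by (auto simp: tensor_carrier tensor_add lift_class pm_extend_add)

lemma lift_smult: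
  "T \<in> carrier (V \<otimes>\<^sub>r W) \<Longrightarrow>
    tensor_lift \<beta> (c \<odot>\<^bsub>V \<otimes>\<^sub>r W\<^esub> T) = pm_scale c (tensor_lift \<beta> T)"
  by (auto simp: tensor_carrier tensor_smult lift_class pm_extend_scale)

lemma lift_act:
  assumes "representation G field_ring V" "representation G field_ring W" "g \<in> carrier G"
    and "module_hom pm_scale pm_scale h"
    and equivariant: "\<And>v w. v \<in> carrier V \<Longrightarrow> w \<in> carrier W \<Longrightarrow> \<beta> (act V g v) (act W g w) = h (\<beta> v w)"
    and "T \<in> carrier (V \<otimes>\<^sub>r W)"
  shows "tensor_lift \<beta> (act (V \<otimes>\<^sub>r W) g T) = h (tensor_lift \<beta> T)"
proof -
  interpret h: module_hom pm_scale pm_scale h by fact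
  obtain F where F: "F \<in> tensor_free V W" "T = tensor_class V W F"
    using assms(6) by (auto simp: tensor_carrier)
  have "pm_extend (case_prod \<beta>) (tensor_free_act V W g F) = pm_extend (\<lambda>(v, w). h (\<beta> v w)) F"
    unfolding tensor_free_act_def pm_extend_compose
    by (rule pm_extend_cong) (use F(1) equivariant in \<open>auto simp: tensor_free_def\<close>)
  also have "\<dots> = h (pm_extend (case_prod \<beta>) F)"
    by (simp add: pm_extend_def h.sum h.scale case_prod_unfold)
  finally show ?thesis by (simp add: F(2) tensor_act[OF assms(1-3)] lift_class)
qed

lemma lift_mem:
  assumes "pm.subspace S" "\<And>v w. v \<in> carrier V \<Longrightarrow> w \<in> carrier W \<Longrightarrow> \<beta> v w \<in> S"
    and "T \<in> carrier (V \<otimes>\<^sub>r W)"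
  shows "tensor_lift \<beta> T \<in> S"
proof -
  obtain F where F: "F \<in> tensor_free V W" "T = tensor_class V W F"
    using assms(3) by (auto simp: tensor_carrier)
  then have "pm_extend (case_prod \<beta>) F \<in> S"
    unfolding pm_extend_def tensor_free_def
    by (intro pm.subspace_sum[OF assms(1)] pm.subspace_scale[OF assms(1)]) (auto intro: assms(2))
  then show ?thesis by (simp add: F(2) lift_class)
qed

text \<open>
  A criterion for the induced map to be bijective: \<open>\<sigma>\<close> picks for each basis element of the target a
  pure tensor that maps to it, and modulo the relations every pure tensor is recovered from its
  image through \<open>\<sigma>\<close>. So the linear extension of \<open>\<sigma>\<close> is a two-sided inverse.
\<close>

lemma bij_lift:
  assumes "pm.subspace S" "\<And>v w. v \<in> carrier V \<Longrightarrow> w \<in> carrier W \<Longrightarrow> \<beta> v w \<in> S"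
    and section_free: "\<And>b R. R \<in> S \<Longrightarrow> b \<in> Poly_Mapping.keys R \<Longrightarrow>
        \<sigma> b \<in> carrier V \<times> carrier W \<and> case_prod \<beta> (\<sigma> b) = Poly_Mapping.single b 1"
    and retract: "\<And>v w. v \<in> carrier V \<Longrightarrow> w \<in> carrier W \<Longrightarrow>
        Poly_Mapping.single (v, w) 1 - pm_extend (\<lambda>b. Poly_Mapping.single (\<sigma> b) 1) (\<beta> v w)
          \<in> tensor_relations V W"
  shows "bij_betw (tensor_lift \<beta>) (carrier (V \<otimes>\<^sub>r W)) S"
proof -
  let ?\<sigma> = "pm_extend (\<lambda>b. Poly_Mapping.single (\<sigma> b) (1::'k))"
  note sub = subspace_tensor_relations[of V W]
  have retract_all: "F - ?\<sigma> (pm_extend (case_prod \<beta>) F) \<in> tensor_relations V W"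
    if "F \<in> tensor_free V W" for F
  proof -
    have "F - ?\<sigma> (pm_extend (case_prod \<beta>) F) =
      (\<Sum>b\<in>Poly_Mapping.keys F. pm_scale (Poly_Mapping.lookup F b)
        (Poly_Mapping.single b 1 - ?\<sigma> (case_prod \<beta> b)))"
      by (subst mpoly_expand[of F])
        (simp add: pm_extend_def[of _ F] pm_extend_sum pm_extend_scale
          pm.scale_right_diff_distrib sum_subtractf)
    then show ?thesis
      using that retract
      by (auto simp: tensor_free_def intro!: pm.subspace_sum[OF sub] pm.subspace_scale[OF sub])
  qed
  have "inj_on (tensor_lift \<beta>) (carrier (V \<otimes>\<^sub>r W))"
  proof (rule inj_onI)
    fix T T' assume "T \<in> carrier (V \<otimes>\<^sub>r W)" "T' \<in> carrier (V \<otimes>\<^sub>r W)"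
      and eq: "tensor_lift \<beta> T = tensor_lift \<beta> T'"
    then obtain F F' where F: "F \<in> tensor_free V W" "T = tensor_class V W F"
      "F' \<in> tensor_free V W" "T' = tensor_class V W F'" by (auto simp: tensor_carrier)
    then have "pm_extend (case_prod \<beta>) F = pm_extend (case_prod \<beta>) F'"
      using eq by (simp add: lift_class)
    then have "F - F' \<in> tensor_relations V W"
      using pm.subspace_diff[OF sub retract_all[OF F(1)] retract_all[OF F(3)]] by simp
    then show "T = T'" by (simp add: F tensor_class_eq_iff)
  qed
  moreover have "R \<in> tensor_lift \<beta> ` carrier (V \<otimes>\<^sub>r W)" if "R \<in> S" for R
  proof
    have "pm_extend (case_prod \<beta>) (?\<sigma> R) = pm_extend (\<lambda>b. Poly_Mapping.single b 1) R"
      unfolding pm_extend_compose by (rule pm_extend_cong) (use section_free that in auto)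
    then show "R = tensor_lift \<beta> (tensor_class V W (?\<sigma> R))"
      by (simp add: lift_class pm_extend_basis)
    have "?\<sigma> R \<in> tensor_free V W"
      unfolding tensor_free_def
    proof (intro CollectI subsetI)
      fix u assume "u \<in> Poly_Mapping.keys (?\<sigma> R)"
      then obtain b where "b \<in> Poly_Mapping.keys R" "u = \<sigma> b"
        using keys_pm_extend[of "\<lambda>b. Poly_Mapping.single (\<sigma> b) (1::'k)" R] by auto
      then show "u \<in> carrier V \<times> carrier W" using section_free[OF that] by simp
    qed
    then show "tensor_class V W (?\<sigma> R) \<in> carrier (V \<otimes>\<^sub>r W)" by (simp add: tensor_carrier)
  qed
  ultimately show ?thesis
    using lift_mem[OF assms(1,2)] by (auto simp: bij_betw_def)
qed

end

section \<open>Tensoring with a power of the determinant\<close>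

lemma bilinear_det:
  assumes "\<And>T T'. T \<in> carrier V \<Longrightarrow> T' \<in> carrier V \<Longrightarrow> h (T \<oplus>\<^bsub>V\<^esub> T') = h T + h T'"
    and "\<And>c T. T \<in> carrier V \<Longrightarrow> h (c \<odot>\<^bsub>V\<^esub> T) = pm_scale c (h T)"
  shows "bilinear_map V (det_rep s) (\<lambda>T c. pm_scale c (h T))"
  by unfold_locales
    (auto simp: assms det_rep_def pm.scale_right_distrib pm.scale_left_distrib mult.commute)

text \<open>
  Scalars can be moved from the one-dimensional factor to the other one, so a sum of pure tensors
  collapses to a single pure tensor with second component \<open>1\<close>.
\<close>

lemma tensor_det_element:
  fixes V :: "('k::field^2^2, 'k, 'v) rep"
  assumes V: "representation GL2 field_ring V" and "T \<in> carrier (V \<otimes>\<^sub>r det_rep s)"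
  shows "\<exists>v\<in>carrier V. T = tensor_class V (det_rep s) (Poly_Mapping.single (v, 1) 1)"
proof -
  let ?D = "det_rep s :: ('k^2^2, 'k, 'k) rep"
  interpret V: representation GL2 "field_ring" V by fact
  note sub = subspace_tensor_relations[of V ?D]
  have pure: "pm_scale c (Poly_Mapping.single (v, x) 1) - Poly_Mapping.single ((c * x) \<odot>\<^bsub>V\<^esub> v, 1) 1
      \<in> tensor_relations V ?D" if "v \<in> carrier V" for c x v
  proof -
    have "Poly_Mapping.single (v, x) 1 - pm_scale x (Poly_Mapping.single (v, 1) 1)
        \<in> tensor_relations V ?D"
      using tensor_relations_smult_right[of v V 1 ?D x] that by (simp add: det_rep_def)
    from pm.subspace_diff[OF sub pm.subspace_scale[OF sub this, of c]
        tensor_relations_smult_left[of v V 1 ?D "c * x"]]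
    show ?thesis using that by (simp add: det_rep_def pm.scale_right_diff_distrib)
  qed
  have sum: "Poly_Mapping.single (v, 1) 1 + Poly_Mapping.single (v', 1) 1
      - Poly_Mapping.single (v \<oplus>\<^bsub>V\<^esub> v', 1) 1 \<in> tensor_relations V ?D"
    if "v \<in> carrier V" "v' \<in> carrier V" for v v'
  proof -
    have "Poly_Mapping.single (v \<oplus>\<^bsub>V\<^esub> v', 1) 1 - Poly_Mapping.single (v, 1) 1
        - Poly_Mapping.single (v', 1) 1 \<in> tensor_relations V ?D"
      by (rule tensor_relations_add_left) (use that in \<open>auto simp: det_rep_def\<close>)
    from pm.subspace_neg[OF sub this] show ?thesis by (simp add: algebra_simps)
  qed
  obtain F where F: "F \<in> tensor_free V ?D" "T = tensor_class V ?D F"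
    using assms(2) by (auto simp: tensor_carrier)
  have "\<exists>v\<in>carrier V. (\<Sum>b\<in>B. pm_scale (Poly_Mapping.lookup F b) (Poly_Mapping.single b 1))
      - Poly_Mapping.single (v, 1) 1 \<in> tensor_relations V ?D"
    if "finite B" "B \<subseteq> Poly_Mapping.keys F" for B
    using that
  proof (induction B)
    case empty
    have "Poly_Mapping.single (0 \<odot>\<^bsub>V\<^esub> \<zero>\<^bsub>V\<^esub>, 1) 1 - pm_scale 0 (Poly_Mapping.single (\<zero>\<^bsub>V\<^esub>, 1) 1)
        \<in> tensor_relations V ?D"
      by (rule tensor_relations_smult_left) (auto simp: det_rep_def)
    then have "Poly_Mapping.single (\<zero>\<^bsub>V\<^esub>, 1) 1 \<in> tensor_relations V ?D"
      using V.smult_l_null[of "\<zero>\<^bsub>V\<^esub>"] by simp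
    then show ?case
      using pm.subspace_neg[OF sub] by (intro bexI[of _ "\<zero>\<^bsub>V\<^esub>"]) auto
  next
    case (insert b B)
    then obtain v where v: "v \<in> carrier V"
      "(\<Sum>b\<in>B. pm_scale (Poly_Mapping.lookup F b) (Poly_Mapping.single b 1))
        - Poly_Mapping.single (v, 1) 1 \<in> tensor_relations V ?D" by auto
    obtain u x where b: "b = (u, x)" by (cases b)
    with insert F(1) have u: "u \<in> carrier V" by (auto simp: tensor_free_def)
    define w where "w = (Poly_Mapping.lookup F b * x) \<odot>\<^bsub>V\<^esub> u"
    have w: "w \<in> carrier V" using u by (simp add: w_def)
    have "pm_scale (Poly_Mapping.lookup F b) (Poly_Mapping.single b 1) - Poly_Mapping.single (w, 1) 1
        \<in> tensor_relations V ?D"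
      using pure[OF u] by (simp add: w_def b)
    from pm.subspace_add[OF sub pm.subspace_add[OF sub this v(2)] sum[OF w v(1)]]
    show ?case using insert v(1) w by (intro bexI[of _ "w \<oplus>\<^bsub>V\<^esub> v"]) (auto simp: algebra_simps)
  qed
  from this[of "Poly_Mapping.keys F"] obtain v where "v \<in> carrier V"
    "(\<Sum>b\<in>Poly_Mapping.keys F. pm_scale (Poly_Mapping.lookup F b) (Poly_Mapping.single b 1))
      - Poly_Mapping.single (v, 1) 1 \<in> tensor_relations V ?D" by auto
  moreover from this(2) have "F - Poly_Mapping.single (v, 1) 1 \<in> tensor_relations V ?D"
    by (subst mpoly_expand[of F]) simp
  ultimately show ?thesis using F(2) tensor_class_eq_iff by blast
qed

text \<open>
  Every element of the tensor product is a pure tensor of some \<open>v\<close> and \<open>1\<close>, and the induced map sends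
  it to \<open>h v\<close>.
\<close>

lemma bij_lift_det:
  fixes V :: "('k::field^2^2, 'k, 'v) rep"
  assumes V: "representation GL2 field_ring V"
    and "\<And>T T'. T \<in> carrier V \<Longrightarrow> T' \<in> carrier V \<Longrightarrow> h (T \<oplus>\<^bsub>V\<^esub> T') = h T + h T'"
    and "\<And>c T. T \<in> carrier V \<Longrightarrow> h (c \<odot>\<^bsub>V\<^esub> T) = pm_scale c (h T)"
    and bij: "bij_betw h (carrier V) S"
  shows "bij_betw (tensor_lift (\<lambda>T c. pm_scale c (h T))) (carrier (V \<otimes>\<^sub>r det_rep s)) S"
proof -
  let ?D = "det_rep s :: ('k^2^2, 'k, 'k) rep"
  let ?pure = "\<lambda>v. tensor_class V ?D (Poly_Mapping.single (v, 1) 1)"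
  interpret bilinear_map V ?D "\<lambda>T c. pm_scale c (h T)" using assms(2,3) by (rule bilinear_det)
  have "carrier (V \<otimes>\<^sub>r ?D) = ?pure ` carrier V"
  proof (intro subset_antisym subsetI)
    fix T assume "T \<in> carrier (V \<otimes>\<^sub>r ?D)"
    then show "T \<in> ?pure ` carrier V" using tensor_det_element[OF V] by blast
  qed (auto simp: tensor_carrier tensor_free_def det_rep_def)
  moreover have "tensor_lift (\<lambda>T c. pm_scale c (h T)) (?pure v) = h v" for v
    by (simp add: lift_class)
  ultimately show ?thesis
    using bij by (auto simp: bij_betw_def inj_on_def image_image)
qed

section \<open>The tensor product of two polynomial representations\<close>

primrec shift_var :: "nat \<Rightarrow> xyvar \<Rightarrow> xyvar" where
  "shift_var f (VarX i) = VarX (f + i)"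
| "shift_var f (VarY i) = VarY (f + i)"

definition shift :: "nat \<Rightarrow> 'k::field mpoly \<Rightarrow> 'k mpoly" where
  "shift f = mpoly_subst (\<lambda>z. mvar (shift_var f z))"

definition shift_exponent :: "nat \<Rightarrow> (xyvar \<Rightarrow>\<^sub>0 nat) \<Rightarrow> (xyvar \<Rightarrow>\<^sub>0 nat)" where
  "shift_exponent f e = (\<Sum>z\<in>Poly_Mapping.keys e. Poly_Mapping.single (shift_var f z) (Poly_Mapping.lookup e z))"

definition concat_degree :: "nat \<Rightarrow> (nat \<Rightarrow> int) \<Rightarrow> (nat \<Rightarrow> int) \<Rightarrow> nat \<Rightarrow> int" where
  "concat_degree f k k' t = (if t < f then k t else k' (t - f))"

lemma shift_single: "shift f (Poly_Mapping.single e c) = Poly_Mapping.single (shift_exponent f e) (c :: 'k::field)"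
proof -
  have "(\<Prod>z\<in>S. Poly_Mapping.single (h z) (1::'k)) = Poly_Mapping.single (\<Sum>z\<in>S. h z) 1"
    if "finite S" for S and h :: "xyvar \<Rightarrow> xyvar \<Rightarrow>\<^sub>0 nat"
    using that by (induction S) (auto simp: mult_single)
  then show ?thesis by (simp add: shift_def shift_exponent_def mpoly_mon_def mvar_power)
qed

lemma lookup_shift_exponent:
  "Poly_Mapping.lookup (shift_exponent f e) (VarX t) = (if f \<le> t then Poly_Mapping.lookup e (VarX (t - f)) else 0)"
  "Poly_Mapping.lookup (shift_exponent f e) (VarY t) = (if f \<le> t then Poly_Mapping.lookup e (VarY (t - f)) else 0)"
proof -
  have shifted: "Poly_Mapping.lookup (shift_exponent f e) z =
      (\<Sum>z'\<in>Poly_Mapping.keys e. if shift_var f z' = z then Poly_Mapping.lookup e z' else 0)" for z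
    by (simp add: shift_exponent_def lookup_sum lookup_single when_def)
  have inj: "shift_var f z' = z \<longleftrightarrow> z' = w" if "shift_var f w = z" for z z' w
    using that by (cases w; cases z') auto
  have hit: "Poly_Mapping.lookup (shift_exponent f e) z = Poly_Mapping.lookup e w"
    if "shift_var f w = z" for z w
    unfolding shifted inj[OF that] by (simp add: in_keys_iff)
  have miss: "Poly_Mapping.lookup (shift_exponent f e) z = 0" if "\<forall>w. shift_var f w \<noteq> z" for z
    unfolding shifted using that by simp
  have missed: "shift_var f w \<noteq> VarX t" "shift_var f w \<noteq> VarY t" if "\<not> f \<le> t" for w
    using that by (cases w; simp)+
  show "Poly_Mapping.lookup (shift_exponent f e) (VarX t) = (if f \<le> t then Poly_Mapping.lookup e (VarX (t - f)) else 0)"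
    "Poly_Mapping.lookup (shift_exponent f e) (VarY t) = (if f \<le> t then Poly_Mapping.lookup e (VarY (t - f)) else 0)"
    using hit[of "VarX (t - f)" "VarX t"] hit[of "VarY (t - f)" "VarY t"]
      miss[of "VarX t"] miss[of "VarY t"] missed by auto
qed

text \<open>
  A monomial in \<open>f + f\<close> pairs of variables is a monomial in the first \<open>f\<close> pairs times a shifted
  one. Injectivity is read off the exponents, and surjectivity follows by counting.
\<close>

lemma bij_exponents_concat:
  "bij_betw (\<lambda>(a, b). a + shift_exponent f b) (exponents f k \<times> exponents f k')
    (exponents (f + f) (concat_degree f k k'))"
proof -
  let ?c = "\<lambda>(a, b). a + shift_exponent f b"
  have inj: "inj_on ?c (exponents f k \<times> exponents f k')"
  proof (rule inj_onI, clarify)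
    fix a b a' b' assume *: "a \<in> exponents f k" "b \<in> exponents f k'" "a' \<in> exponents f k"
      "b' \<in> exponents f k'" "a + shift_exponent f b = a' + shift_exponent f b'"
    then have look: "Poly_Mapping.lookup (a + shift_exponent f b) z = Poly_Mapping.lookup (a' + shift_exponent f b') z" for z
      by simp
    have "Poly_Mapping.lookup a z = Poly_Mapping.lookup a' z" for z
      using look[of z] *(1,3) by (cases z; cases "f \<le> var_index z")
        (auto simp: lookup_add lookup_shift_exponent exponents_iff)
    moreover have "Poly_Mapping.lookup b z = Poly_Mapping.lookup b' z" for z
      using look[of "shift_var f z"] *(1,3) by (cases z)
        (auto simp: lookup_add lookup_shift_exponent exponents_iff)
    ultimately show "a = a' \<and> b = b'" by (simp add: poly_mapping_eqI)
  qed
  have "?c ` (exponents f k \<times> exponents f k') \<subseteq> exponents (f + f) (concat_degree f k k')"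
    by (auto simp: exponents_iff lookup_add lookup_shift_exponent concat_degree_def)
  moreover have "card (exponents f k \<times> exponents f k') = card (exponents (f + f) (concat_degree f k k'))"
    by (simp add: card_cartesian_product card_exponents prod_lessThan_add concat_degree_def)
  ultimately have "?c ` (exponents f k \<times> exponents f k') = exponents (f + f) (concat_degree f k k')"
    using inj by (intro card_subset_eq) (simp_all add: card_exponents card_image)
  with inj show ?thesis by (simp add: bij_betw_def)
qed

lemma tensor_relations_sum_left:
  fixes W :: "('k::field^2^2, 'k, 'w) rep"
  assumes "finite B" "\<And>e. e \<in> B \<Longrightarrow> M e \<in> multihom f k" "w \<in> carrier W"
  shows "Poly_Mapping.single (\<Sum>e\<in>B. pm_scale (a e) (M e), w) 1
      - (\<Sum>e\<in>B. pm_scale (a e) (Poly_Mapping.single (M e, w) 1)) \<in> tensor_relations (poly_rep p f k) W"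
  using assms(1,2)
proof (induction B)
  case empty
  show ?case
    using tensor_relations_smult_left[of 0 "poly_rep p f k" w W 0] assms(3)
    by (simp add: poly_rep_def multihom_0)
next
  case (insert e B)
  let ?V = "poly_rep p f k :: ('k^2^2, 'k, 'k mpoly) rep"
  note sub = subspace_tensor_relations[of ?V W]
  have mem: "M e \<in> multihom f k" "pm_scale (a e) (M e) \<in> multihom f k"
    "(\<Sum>e\<in>B. pm_scale (a e) (M e)) \<in> multihom f k"
    using insert.prems by (auto intro!: multihom_scale multihom_sum)
  have "Poly_Mapping.single (pm_scale (a e) (M e) + (\<Sum>e\<in>B. pm_scale (a e) (M e)), w) 1
      - Poly_Mapping.single (pm_scale (a e) (M e), w) 1
      - Poly_Mapping.single (\<Sum>e\<in>B. pm_scale (a e) (M e), w) 1 \<in> tensor_relations ?V W"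
    using tensor_relations_add_left[of "pm_scale (a e) (M e)" ?V "\<Sum>e\<in>B. pm_scale (a e) (M e)" w W]
      mem assms(3) by (simp add: poly_rep_def)
  moreover have "Poly_Mapping.single (pm_scale (a e) (M e), w) 1
      - pm_scale (a e) (Poly_Mapping.single (M e, w) 1) \<in> tensor_relations ?V W"
    using tensor_relations_smult_left[of "M e" ?V w W "a e"] mem assms(3) by (simp add: poly_rep_def)
  ultimately have "Poly_Mapping.single (pm_scale (a e) (M e) + (\<Sum>e\<in>B. pm_scale (a e) (M e)), w) 1
      - Poly_Mapping.single (\<Sum>e\<in>B. pm_scale (a e) (M e), w) 1
      - pm_scale (a e) (Poly_Mapping.single (M e, w) 1) \<in> tensor_relations ?V W"
    using pm.subspace_add[OF sub] by fastforce
  from pm.subspace_add[OF sub this insert.IH] show ?case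
    using insert by (simp add: algebra_simps)
qed

lemma tensor_relations_sum_right:
  fixes V :: "('k::field^2^2, 'k, 'v) rep"
  assumes "finite B" "\<And>e. e \<in> B \<Longrightarrow> M e \<in> multihom f k" "v \<in> carrier V"
  shows "Poly_Mapping.single (v, \<Sum>e\<in>B. pm_scale (a e) (M e)) 1
      - (\<Sum>e\<in>B. pm_scale (a e) (Poly_Mapping.single (v, M e) 1)) \<in> tensor_relations V (poly_rep p f k)"
  using assms(1,2)
proof (induction B)
  case empty
  show ?case
    using tensor_relations_smult_right[of v V 0 "poly_rep p f k" 0] assms(3)
    by (simp add: poly_rep_def multihom_0)
next
  case (insert e B)
  let ?W = "poly_rep p f k :: ('k^2^2, 'k, 'k mpoly) rep"
  note sub = subspace_tensor_relations[of V ?W]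
  have mem: "M e \<in> multihom f k" "pm_scale (a e) (M e) \<in> multihom f k"
    "(\<Sum>e\<in>B. pm_scale (a e) (M e)) \<in> multihom f k"
    using insert.prems by (auto intro!: multihom_scale multihom_sum)
  have "Poly_Mapping.single (v, pm_scale (a e) (M e) + (\<Sum>e\<in>B. pm_scale (a e) (M e))) 1
      - Poly_Mapping.single (v, pm_scale (a e) (M e)) 1
      - Poly_Mapping.single (v, \<Sum>e\<in>B. pm_scale (a e) (M e)) 1 \<in> tensor_relations V ?W"
    using tensor_relations_add_right[of v V "pm_scale (a e) (M e)" ?W "\<Sum>e\<in>B. pm_scale (a e) (M e)"]
      mem assms(3) by (simp add: poly_rep_def)
  moreover have "Poly_Mapping.single (v, pm_scale (a e) (M e)) 1
      - pm_scale (a e) (Poly_Mapping.single (v, M e) 1) \<in> tensor_relations V ?W"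
    using tensor_relations_smult_right[of v V "M e" ?W "a e"] mem assms(3) by (simp add: poly_rep_def)
  ultimately have "Poly_Mapping.single (v, pm_scale (a e) (M e) + (\<Sum>e\<in>B. pm_scale (a e) (M e))) 1
      - Poly_Mapping.single (v, \<Sum>e\<in>B. pm_scale (a e) (M e)) 1
      - pm_scale (a e) (Poly_Mapping.single (v, M e) 1) \<in> tensor_relations V ?W"
    using pm.subspace_add[OF sub] by fastforce
  from pm.subspace_add[OF sub this insert.IH] show ?case
    using insert by (simp add: algebra_simps)
qed

text \<open>
  The index \<open>f + i\<close> calls for the power \<open>p ^ (f + i)\<close> of the entries of \<open>A\<close>, which \<open>twist\<close> identifies
  with the power \<open>p ^ i\<close> used before the shift.
\<close>

lemma shift_act:
  fixes A :: "'k::field^2^2"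
  assumes twist: "\<And>(x :: 'k) i. x ^ (p ^ (f + i)) = x ^ (p ^ i)"
  shows "shift f (mpoly_subst (gl2_var p A) Q) = mpoly_subst (gl2_var p A) (shift f Q)"
proof -
  have "mpoly_subst (\<lambda>z. mvar (shift_var f z)) (gl2_var p A z) =
      mpoly_subst (gl2_var p A) (mvar (shift_var f z))" for z
    by (cases z) (simp_all add: mpoly_subst_add mpoly_subst_scale twist)
  then show ?thesis unfolding shift_def mpoly_subst_compose by presburger
qed

lemma bilinear_mult_shift:
  "bilinear_map (poly_rep p f k) (poly_rep p f k') (\<lambda>P Q. P * shift f Q)"
  by unfold_locales
    (simp_all add: poly_rep_def shift_def mpoly_subst_add mpoly_subst_scale distrib_left distrib_right
      pm_scale_mult_left pm_scale_mult_right)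

lemma mult_shift_expand:
  "P * shift f Q = (\<Sum>a\<in>Poly_Mapping.keys P. \<Sum>b\<in>Poly_Mapping.keys Q. Poly_Mapping.single
      (a + shift_exponent f b) (Poly_Mapping.lookup P a * Poly_Mapping.lookup Q b))"
proof -
  have "shift f Q = (\<Sum>b\<in>Poly_Mapping.keys Q.
      Poly_Mapping.single (shift_exponent f b) (Poly_Mapping.lookup Q b))"
    by (subst mpoly_expand[of Q])
      (simp add: shift_def mpoly_subst_sum shift_single[unfolded shift_def] del: mpoly_subst_single)
  then show ?thesis
    by (subst mpoly_expand[of P]) (simp add: sum_product mult_single)
qed

lemma mult_shift_mem:
  assumes "P \<in> multihom f k" "Q \<in> multihom f k'"
  shows "P * shift f Q \<in> multihom (f + f) (concat_degree f k k')"
  unfolding mult_shift_expand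
proof (intro multihom_sum single_in_multihom)
  fix a b assume "a \<in> Poly_Mapping.keys P" "b \<in> Poly_Mapping.keys Q"
  then have "(a, b) \<in> exponents f k \<times> exponents f k'" using assms by (auto simp: multihom_eq)
  then show "a + shift_exponent f b \<in> exponents (f + f) (concat_degree f k k')"
    using bij_betwE[OF bij_exponents_concat] by fastforce
qed

text \<open>
  The products of a monomial and a shifted monomial are exactly the monomials of the model, so
  the tensors of monomials give the section that \<open>bij_lift\<close> asks for. To recover a general pure
  tensor, both of its components are expanded into monomials.
\<close>

lemma bij_tensor_lift_mult_shift:
  "bij_betw (tensor_lift (\<lambda>P Q. P * shift f Q))
    (carrier (poly_rep p f k \<otimes>\<^sub>r poly_rep p f k' :: ('k::field^2^2, 'k, ('k mpoly \<times> 'k mpoly \<Rightarrow>\<^sub>0 'k) set) rep))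
    (multihom (f + f) (concat_degree f k k'))"
proof -
  let ?V = "poly_rep p f k :: ('k^2^2, 'k, 'k mpoly) rep"
  let ?W = "poly_rep p f k' :: ('k^2^2, 'k, 'k mpoly) rep"
  let ?c = "\<lambda>(a, b). a + shift_exponent f b"
  define X where "X = exponents f k \<times> exponents f k'"
  define \<sigma> where "\<sigma> e = (case inv_into X ?c e of (a, b) \<Rightarrow>
    (Poly_Mapping.single a (1::'k), Poly_Mapping.single b (1::'k)))" for e
  have bij: "bij_betw ?c X (exponents (f + f) (concat_degree f k k'))"
    unfolding X_def by (rule bij_exponents_concat)
  have \<sigma>: "\<sigma> (a + shift_exponent f b) = (Poly_Mapping.single a 1, Poly_Mapping.single b 1)"
    if "(a, b) \<in> X" for a b
    using bij_betw_inv_into_left[OF bij that] by (simp add: \<sigma>_def)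
  have carrier: "carrier ?V = multihom f k" "carrier ?W = multihom f k'" by (simp_all add: poly_rep_def)
  interpret bilinear_map ?V ?W "\<lambda>P Q. P * shift f Q" by (rule bilinear_mult_shift)
  show ?thesis
  proof (rule bij_lift[OF subspace_multihom])
    show "P * shift f Q \<in> multihom (f + f) (concat_degree f k k')"
      if "P \<in> carrier ?V" "Q \<in> carrier ?W" for P Q
      using that unfolding carrier by (rule mult_shift_mem)
  next
    fix e and R :: "'k mpoly"
    assume "R \<in> multihom (f + f) (concat_degree f k k')" "e \<in> Poly_Mapping.keys R"
    then have "e \<in> ?c ` X" using bij by (auto simp: multihom_eq bij_betw_def)
    then obtain a b where ab: "(a, b) \<in> X" "e = a + shift_exponent f b" by auto
    then show "\<sigma> e \<in> carrier ?V \<times> carrier ?W \<and>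
        (case \<sigma> e of (P, Q) \<Rightarrow> P * shift f Q) = Poly_Mapping.single e 1"
      unfolding ab(2) \<sigma>[OF ab(1)] carrier
      by (auto simp: X_def single_in_multihom shift_single mult_single)
  next
    fix P Q assume "P \<in> carrier ?V" "Q \<in> carrier ?W"
    then have P: "P \<in> multihom f k" and Q: "Q \<in> multihom f k'" by (simp_all add: carrier)
    note sub = subspace_tensor_relations[of ?V ?W]
    let ?m = "\<lambda>e. Poly_Mapping.single e (1::'k)"
    let ?l = Poly_Mapping.lookup
    have mono: "?m a \<in> multihom f k" if "a \<in> Poly_Mapping.keys P" for a
      using that P by (auto simp: multihom_eq)
    have mono': "?m b \<in> multihom f k'" if "b \<in> Poly_Mapping.keys Q" for b
      using that Q by (auto simp: multihom_eq)
    have expand: "(\<Sum>a\<in>Poly_Mapping.keys R. pm_scale (?l R a) (?m a)) = R" for R :: "'k mpoly"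
      by (subst (3) mpoly_expand) simp
    \<comment> \<open>expanding the first component, and then the second\<close>
    have left: "Poly_Mapping.single (P, Q) 1
        - (\<Sum>a\<in>Poly_Mapping.keys P. pm_scale (?l P a) (Poly_Mapping.single (?m a, Q) 1))
        \<in> tensor_relations ?V ?W"
      using tensor_relations_sum_left[of "Poly_Mapping.keys P" ?m f k Q ?W "?l P" p] mono Q
      by (simp only: expand carrier finite_keys simp_thms)
    have right: "Poly_Mapping.single (?m a, Q) 1
        - (\<Sum>b\<in>Poly_Mapping.keys Q. pm_scale (?l Q b) (Poly_Mapping.single (?m a, ?m b) 1))
        \<in> tensor_relations ?V ?W" if "a \<in> Poly_Mapping.keys P" for a
      using tensor_relations_sum_right[of "Poly_Mapping.keys Q" ?m f k' "?m a" ?V "?l Q" p] mono[OF that] mono'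
      by (simp only: expand carrier finite_keys simp_thms)
    have "pm_extend (\<lambda>e. Poly_Mapping.single (\<sigma> e) 1) (P * shift f Q) =
      (\<Sum>a\<in>Poly_Mapping.keys P. \<Sum>b\<in>Poly_Mapping.keys Q.
        pm_scale (?l P a * ?l Q b) (Poly_Mapping.single (?m a, ?m b) 1))"
      unfolding mult_shift_expand pm_extend_sum pm_extend_single
    proof (intro sum.cong refl)
      fix a b assume "a \<in> Poly_Mapping.keys P" "b \<in> Poly_Mapping.keys Q"
      then have "(a, b) \<in> X" using P Q by (auto simp: multihom_eq X_def)
      then show "pm_scale (?l P a * ?l Q b) (Poly_Mapping.single (\<sigma> (a + shift_exponent f b)) 1) =
          pm_scale (?l P a * ?l Q b) (Poly_Mapping.single (?m a, ?m b) (1::'k))"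
        by (simp only: \<sigma>)
    qed
    then have "Poly_Mapping.single (P, Q) 1 - pm_extend (\<lambda>e. Poly_Mapping.single (\<sigma> e) 1) (P * shift f Q) =
      (Poly_Mapping.single (P, Q) 1
        - (\<Sum>a\<in>Poly_Mapping.keys P. pm_scale (?l P a) (Poly_Mapping.single (?m a, Q) 1)))
      + (\<Sum>a\<in>Poly_Mapping.keys P. pm_scale (?l P a) (Poly_Mapping.single (?m a, Q) 1
        - (\<Sum>b\<in>Poly_Mapping.keys Q. pm_scale (?l Q b) (Poly_Mapping.single (?m a, ?m b) 1))))"
      by (simp only: pm.scale_right_diff_distrib pm.scale_sum_right pm.scale_scale sum_subtractf)
        (simp add: algebra_simps)
    also have "\<dots> \<in> tensor_relations ?V ?W"
      by (intro pm.subspace_add[OF sub] pm.subspace_sum[OF sub] pm.subspace_scale[OF sub] left right)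
    finally show "Poly_Mapping.single (P, Q) 1
      - pm_extend (\<lambda>e. Poly_Mapping.single (\<sigma> e) 1) (P * shift f Q) \<in> tensor_relations ?V ?W" .
  qed
qed

section \<open>Isomorphisms through a common model\<close>

text \<open>
  The isomorphism is \<open>\<alpha>\<close> followed by the inverse of \<open>\<gamma>\<close>. Injectivity of \<open>\<gamma>\<close> reduces its linearity and
  equivariance to equations in the model.
\<close>

lemma rep_isomorphic_common_model:
  fixes V :: "('g, 'k::field, 'v) rep" and W :: "('g, 'k, 'w) rep" and U :: "('b \<Rightarrow>\<^sub>0 'k) set"
  assumes V: "representation G field_ring V" and W: "representation G field_ring W"
    and \<alpha>: "bij_betw \<alpha> (carrier V) U" and \<gamma>: "bij_betw \<gamma> (carrier W) U"
    and \<alpha>_add: "\<And>v v'. v \<in> carrier V \<Longrightarrow> v' \<in> carrier V \<Longrightarrow> \<alpha> (v \<oplus>\<^bsub>V\<^esub> v') = \<alpha> v + \<alpha> v'"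
    and \<gamma>_add: "\<And>w w'. w \<in> carrier W \<Longrightarrow> w' \<in> carrier W \<Longrightarrow> \<gamma> (w \<oplus>\<^bsub>W\<^esub> w') = \<gamma> w + \<gamma> w'"
    and \<alpha>_smult: "\<And>c v. v \<in> carrier V \<Longrightarrow> \<alpha> (c \<odot>\<^bsub>V\<^esub> v) = pm_scale c (\<alpha> v)"
    and \<gamma>_smult: "\<And>c w. w \<in> carrier W \<Longrightarrow> \<gamma> (c \<odot>\<^bsub>W\<^esub> w) = pm_scale c (\<gamma> w)"
    and \<alpha>_act: "\<And>g v. g \<in> carrier G \<Longrightarrow> v \<in> carrier V \<Longrightarrow> \<alpha> (act V g v) = \<rho> g (\<alpha> v)"
    and \<gamma>_act: "\<And>g w. g \<in> carrier G \<Longrightarrow> w \<in> carrier W \<Longrightarrow> \<gamma> (act W g w) = \<rho> g (\<gamma> w)"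
  shows "rep_isomorphic G field_ring V W"
proof -
  interpret V: representation G "field_ring" V by fact
  interpret W: representation G "field_ring" W by fact
  define \<phi> where "\<phi> = inv_into (carrier W) \<gamma> \<circ> \<alpha>"
  have bij: "bij_betw \<phi> (carrier V) (carrier W)"
    unfolding \<phi>_def using \<alpha> bij_betw_inv_into[OF \<gamma>] by (rule bij_betw_trans)
  have mem: "\<phi> v \<in> carrier W" if "v \<in> carrier V" for v using bij_betwE[OF bij] that by blast
  have \<gamma>\<phi>: "\<gamma> (\<phi> v) = \<alpha> v" if "v \<in> carrier V" for v
    using bij_betw_inv_into_right[OF \<gamma>] bij_betwE[OF \<alpha>] that by (simp add: \<phi>_def)
  have eqI: "\<phi> v = w" if "v \<in> carrier V" "w \<in> carrier W" "\<alpha> v = \<gamma> w" for v w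
    using inj_onD[OF bij_betw_imp_inj_on[OF \<gamma>] _ mem[OF that(1)] that(2)] \<gamma>\<phi>[OF that(1)] that(3) by simp
  have "\<phi> \<in> iso (add_monoid V) (add_monoid W)"
    using bij by (auto simp: iso_def hom_def mem \<gamma>\<phi> \<alpha>_add \<gamma>_add intro!: eqI)
  moreover have "\<phi> (c \<odot>\<^bsub>V\<^esub> v) = c \<odot>\<^bsub>W\<^esub> \<phi> v" if "v \<in> carrier V" for c v
    using that by (intro eqI) (auto simp: mem \<gamma>\<phi> \<alpha>_smult \<gamma>_smult)
  moreover have "\<phi> (act V g v) = act W g (\<phi> v)" if "g \<in> carrier G" "v \<in> carrier V" for g v
    using that by (intro eqI) (auto simp: mem \<gamma>\<phi> \<alpha>_act \<gamma>_act V.act_closed W.act_closed)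
  ultimately show ?thesis unfolding rep_isomorphic_def by blast
qed

section \<open>The decomposition\<close>

text \<open>
  Multiplication by a nonzero \<open>x\<close> permutes the nonzero elements; comparing the products of all of
  them before and after shows that \<open>x ^ (CARD('k) - 1) = 1\<close>.
\<close>

lemma finite_field_power_card:
  fixes x :: "'k::{field,finite}"
  shows "x ^ CARD('k) = x"
proof (cases "x = 0")
  case True
  then show ?thesis by (simp add: power_0_left)
next
  case False
  let ?U = "UNIV - {0 :: 'k}"
  have "bij_betw ((*) x) ?U ?U"
    by (rule bij_betw_byWitness[where f' = "\<lambda>y. y / x"]) (use False in auto)
  then have "\<Prod>?U = (\<Prod>y\<in>?U. x * y)" by (rule prod.reindex_bij_betw[where g = "\<lambda>y. y", symmetric])
  also have "\<dots> = x ^ card ?U * \<Prod>?U" by (simp add: prod.distrib)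
  finally have "x ^ card ?U = 1" by simp
  moreover have "CARD('k) = Suc (card ?U)" using card_Suc_Diff1[of UNIV "0 :: 'k"] by simp
  ultimately show ?thesis by (simp only: power_Suc mult_1_right)
qed

lemma multihom_split_degree:
  "multihom (f + f) (concat_degree f (\<lambda>i. int (m i) - int (l i) + (1 - int (l i)) * int (n i))
      (\<lambda>i. int (l i) * int (n i) - int (l i))) = multihom (f + f) (split_degree f m n f l)"
  "multihom (f + f) (concat_degree f (\<lambda>i. int (m i)) (\<lambda>i. int (n i))) =
    multihom (f + f) (split_degree f m n 0 l)"
  by (rule multihom_cong; auto simp: concat_degree_def split_degree_def)+

theorem theorem2p14:
  fixes p f :: nat and m n :: "nat \<Rightarrow> nat"
  assumes "prime p" and "f \<ge> 1" and "CARD('k::{field,finite}) = p ^ f"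
    and "\<forall>i<f. \<not> p dvd ((m i + n i) choose (n i))"
  shows "rep_isomorphic GL2 field_ring
    (poly_rep p f (\<lambda>i. int (m i)) \<otimes>\<^sub>r poly_rep p f (\<lambda>i. int (n i)) ::
      ('k^2^2, 'k, ('k mpoly \<times> 'k mpoly \<Rightarrow>\<^sub>0 'k) set) rep)
    (rep_direct_sum ({..<f} \<rightarrow>\<^sub>E {0, 1}) (\<lambda>l.
      poly_rep p f (\<lambda>i. int (m i) - int (l i) + (1 - int (l i)) * int (n i))
      \<otimes>\<^sub>r poly_rep p f (\<lambda>i. int (l i) * int (n i) - int (l i))
      \<otimes>\<^sub>r det_rep (psi p f l)))"
proof -
  have "CHAR('k) dvd p ^ f" using CHAR_dvd_CARD[where 'a = 'k] assms(3) by simp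
  moreover have "prime CHAR('k)" by (rule prime_CHAR_semidom) (simp add: finite_imp_CHAR_pos)
  ultimately have char: "CHAR('k) = p"
    using assms(1) by (metis prime_dvd_power primes_dvd_imp_eq)
  have frob: "(x + y) ^ (p ^ i) = x ^ (p ^ i) + y ^ (p ^ i)" for x y :: 'k and i
    using freshmans_dream'[where ?'a = 'k, of "p ^ i" i x y] assms(1) char by simp
  have twist: "x ^ (p ^ (f + i)) = x ^ (p ^ i)" for x :: 'k and i
    using finite_field_power_card[of x] assms(3) by (simp add: power_add power_mult)
  have binomial: "of_nat ((m i + n i) choose n i) \<noteq> (0 :: 'k)" if "i < f" for i
    using assms(4) that by (simp add: of_nat_eq_0_iff_char_dvd char)

  note rep = representation_poly_rep[OF assms(1,3)]
  define I where "I = {..<f} \<rightarrow>\<^sub>E {0, 1::nat}"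
  have finI: "finite I" unfolding I_def by (intro finite_PiE) auto
  define V where "V l = (poly_rep p f (\<lambda>i. int (m i) - int (l i) + (1 - int (l i)) * int (n i))
      :: ('k^2^2, 'k, 'k mpoly) rep)" for l
  define W where "W l = (poly_rep p f (\<lambda>i. int (l i) * int (n i) - int (l i))
      :: ('k^2^2, 'k, 'k mpoly) rep)" for l
  define T where "T l = V l \<otimes>\<^sub>r W l \<otimes>\<^sub>r det_rep (psi p f l)" for l
  let ?S = "rep_direct_sum I T"
  let ?M = "poly_rep p f (\<lambda>i. int (m i)) :: ('k^2^2, 'k, 'k mpoly) rep"
  let ?N = "poly_rep p f (\<lambda>i. int (n i)) :: ('k^2^2, 'k, 'k mpoly) rep"
  let ?U = "multihom (f + f) (split_degree f m n 0 (\<lambda>_. 0)) :: 'k mpoly set"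
  define \<mu> where "\<mu> = (\<lambda>P Q :: 'k mpoly. P * shift f Q)"
  let ?\<rho> = "\<lambda>A :: 'k^2^2. mpoly_subst (gl2_var p A)"
  have lin: "module_hom pm_scale pm_scale (?\<rho> A)" for A
    by unfold_locales (simp_all add: mpoly_subst_add mpoly_subst_scale)
  have \<mu>_act: "\<mu> (?\<rho> A P) (?\<rho> A Q) = ?\<rho> A (\<mu> P Q)" for A P Q
    by (simp add: \<mu>_def shift_act[OF twist] mpoly_subst_mult)
  interpret MN: bilinear_map ?M ?N \<mu> unfolding \<mu>_def by (rule bilinear_mult_shift)

  \<comment> \<open>\<open>h\<close> maps every tensor product of two polynomial representations into the model\<close>
  define h where "h = tensor_lift \<mu>"
  interpret VW: bilinear_map "V l" "W l" \<mu> for l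
    unfolding \<mu>_def V_def W_def by (rule bilinear_mult_shift)
  have repV: "representation GL2 field_ring (V l)" and repW: "representation GL2 field_ring (W l)" for l
    by (simp_all add: V_def W_def rep)
  have repVW: "representation GL2 field_ring (V l \<otimes>\<^sub>r W l)" for l
    by (rule representation_tensor[OF repV repW])
  have repT: "representation GL2 field_ring (T l)" for l
    unfolding T_def by (rule representation_tensor[OF repVW representation_det_rep])
  have h_bij: "bij_betw h (carrier (V l \<otimes>\<^sub>r W l)) (multihom (f + f) (split_degree f m n f l))" for l
    using bij_tensor_lift_mult_shift unfolding h_def \<mu>_def V_def W_def multihom_split_degree(1)[symmetric] .
  note h_add = VW.lift_add[folded h_def] and h_smult = VW.lift_smult[folded h_def]
  have h_act: "h (act (V l \<otimes>\<^sub>r W l) A t) = ?\<rho> A (h t)"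
    if "A \<in> carrier GL2" "t \<in> carrier (V l \<otimes>\<^sub>r W l)" for A l t
    unfolding h_def
    by (rule VW.lift_act[OF repV repW that(1) lin _ that(2)]) (simp add: V_def W_def poly_rep_def \<mu>_act)

  \<comment> \<open>\<open>\<delta>\<close> extends \<open>h\<close> to the summands, where a power of the determinant is tensored on\<close>
  define \<delta> where "\<delta> = tensor_lift (\<lambda>t c. pm_scale c (h t))"
  interpret T: bilinear_map "V l \<otimes>\<^sub>r W l" "det_rep s" "\<lambda>t c. pm_scale c (h t)" for l s
    by (rule bilinear_det) (use h_add h_smult in auto)
  have \<delta>_bij: "bij_betw \<delta> (carrier (T l)) (multihom (f + f) (split_degree f m n f l))" for l
    unfolding \<delta>_def T_def by (rule bij_lift_det[OF repVW h_add h_smult h_bij])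
  have \<delta>_add: "\<delta> (t \<oplus>\<^bsub>T l\<^esub> t') = \<delta> t + \<delta> t'" if "t \<in> carrier (T l)" "t' \<in> carrier (T l)" for l t t'
    using that unfolding \<delta>_def T_def by (rule T.lift_add)
  have \<delta>_smult: "\<delta> (c \<odot>\<^bsub>T l\<^esub> t) = pm_scale c (\<delta> t)" if "t \<in> carrier (T l)" for l t c
    using that unfolding \<delta>_def T_def by (rule T.lift_smult)
  have \<delta>_act: "\<delta> (act (T l) A t) = pm_scale (det A ^ psi p f l) (?\<rho> A (\<delta> t))"
    if "A \<in> carrier GL2" "t \<in> carrier (T l)" for A l t
    unfolding \<delta>_def T_def
  proof (rule T.lift_act[OF repVW representation_det_rep that(1)])
    show "module_hom pm_scale pm_scale (\<lambda>P. pm_scale (det A ^ psi p f l) (?\<rho> A P))"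
      by unfold_locales (simp_all add: mpoly_subst_add mpoly_subst_scale pm.scale_right_distrib mult.commute)
  qed (use that in \<open>simp_all add: T_def det_rep_def h_act mpoly_subst_scale\<close>)

  \<comment> \<open>the direct sum reaches the model through \<open>\<Delta>\<close> in each summand and then \<open>\<Phi>\<close>\<close>
  define \<Phi> where "\<Phi> y = (\<Sum>l\<in>I. embed_summand f n f l (y l))" for y :: "(nat \<Rightarrow> nat) \<Rightarrow> 'k mpoly"
  define \<Delta> where "\<Delta> x = (\<lambda>l\<in>I. \<delta> (x l))" for x
  have carrierS: "carrier ?S = (\<Pi>\<^sub>E l\<in>I. carrier (T l))"
    using finI by (auto simp: rep_direct_sum_def)
  have "bij_betw \<Delta> (carrier ?S) (\<Pi>\<^sub>E l\<in>I. multihom (f + f) (split_degree f m n f l))"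
    unfolding carrierS
  proof (rule bij_betw_byWitness[where f' = "\<lambda>y. \<lambda>l\<in>I. inv_into (carrier (T l)) \<delta> (y l)"])
    show "\<forall>x\<in>\<Pi>\<^sub>E l\<in>I. carrier (T l). (\<lambda>l\<in>I. inv_into (carrier (T l)) \<delta> (\<Delta> x l)) = x"
      using bij_betw_inv_into_left[OF \<delta>_bij]
      by (auto simp: \<Delta>_def fun_eq_iff PiE_iff extensional_def)
    show "\<forall>y\<in>\<Pi>\<^sub>E l\<in>I. multihom (f + f) (split_degree f m n f l).
        \<Delta> (\<lambda>l\<in>I. inv_into (carrier (T l)) \<delta> (y l)) = y"
      using bij_betw_inv_into_right[OF \<delta>_bij]
      by (auto simp: \<Delta>_def fun_eq_iff PiE_iff extensional_def)
    show "\<Delta> ` (\<Pi>\<^sub>E l\<in>I. carrier (T l)) \<subseteq> (\<Pi>\<^sub>E l\<in>I. multihom (f + f) (split_degree f m n f l))"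
      using bij_betwE[OF \<delta>_bij] by (auto simp: \<Delta>_def PiE_iff)
    show "(\<lambda>y. \<lambda>l\<in>I. inv_into (carrier (T l)) \<delta> (y l)) `
        (\<Pi>\<^sub>E l\<in>I. multihom (f + f) (split_degree f m n f l)) \<subseteq> (\<Pi>\<^sub>E l\<in>I. carrier (T l))"
      using bij_betwE[OF bij_betw_inv_into[OF \<delta>_bij]] by (auto simp: PiE_iff)
  qed
  moreover have "bij_betw \<Phi> (\<Pi>\<^sub>E l\<in>I. multihom (f + f) (split_degree f m n f l)) ?U"
    unfolding \<Phi>_def I_def by (rule bij_sum_embed_summand[OF binomial])
  ultimately have "bij_betw (\<Phi> \<circ> \<Delta>) (carrier ?S) ?U" by (rule bij_betw_trans)

  have act_summand: "?\<rho> A (embed_summand f n f l P) =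
      pm_scale (det A ^ psi p f l) (embed_summand f n f l (?\<rho> A P))" if "l \<in> I" for A l P
    by (rule embed_summand_act[OF frob twist]) (use that in \<open>auto simp: I_def\<close>)

  have "rep_isomorphic GL2 field_ring (?M \<otimes>\<^sub>r ?N) ?S"
  proof (rule rep_isomorphic_common_model[where \<alpha> = h and \<gamma> = "\<Phi> \<circ> \<Delta>" and \<rho> = ?\<rho> and U = ?U])
    show "representation GL2 field_ring (?M \<otimes>\<^sub>r ?N)" by (rule representation_tensor[OF rep rep])
    show "representation GL2 field_ring ?S"
      by (rule representation_direct_sum[OF group_GL2 repT])
    show "bij_betw h (carrier (?M \<otimes>\<^sub>r ?N)) ?U"
      using bij_tensor_lift_mult_shift unfolding h_def \<mu>_def multihom_split_degree(2)[symmetric] .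
    show "bij_betw (\<Phi> \<circ> \<Delta>) (carrier ?S) ?U" by fact
    show "h (v \<oplus>\<^bsub>?M \<otimes>\<^sub>r ?N\<^esub> v') = h v + h v'"
      if "v \<in> carrier (?M \<otimes>\<^sub>r ?N)" "v' \<in> carrier (?M \<otimes>\<^sub>r ?N)" for v v'
      using that unfolding h_def by (rule MN.lift_add)
    show "h (c \<odot>\<^bsub>?M \<otimes>\<^sub>r ?N\<^esub> v) = pm_scale c (h v)" if "v \<in> carrier (?M \<otimes>\<^sub>r ?N)" for c v
      using that unfolding h_def by (rule MN.lift_smult)
    show "h (act (?M \<otimes>\<^sub>r ?N) A v) = ?\<rho> A (h v)"
      if "A \<in> carrier GL2" "v \<in> carrier (?M \<otimes>\<^sub>r ?N)" for A v
      unfolding h_def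
      by (rule MN.lift_act[OF rep rep that(1) lin _ that(2)]) (simp add: poly_rep_def \<mu>_act)
  next
    fix x y assume "x \<in> carrier ?S" "y \<in> carrier ?S"
    then have "\<delta> ((x \<oplus>\<^bsub>?S\<^esub> y) l) = \<delta> (x l) + \<delta> (y l)" if "l \<in> I" for l
      using that \<delta>_add[of "x l" l "y l"] unfolding carrierS by (auto simp: rep_direct_sum_def PiE_iff)
    then show "(\<Phi> \<circ> \<Delta>) (x \<oplus>\<^bsub>?S\<^esub> y) = (\<Phi> \<circ> \<Delta>) x + (\<Phi> \<circ> \<Delta>) y"
      by (simp add: \<Phi>_def \<Delta>_def embed_summand_add sum.distrib)
  next
    fix c x assume "x \<in> carrier ?S"
    then have "\<delta> ((c \<odot>\<^bsub>?S\<^esub> x) l) = pm_scale c (\<delta> (x l))" if "l \<in> I" for l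
      using that \<delta>_smult[of "x l" l c] unfolding carrierS by (auto simp: rep_direct_sum_def PiE_iff)
    then show "(\<Phi> \<circ> \<Delta>) (c \<odot>\<^bsub>?S\<^esub> x) = pm_scale c ((\<Phi> \<circ> \<Delta>) x)"
      by (simp add: \<Phi>_def \<Delta>_def embed_summand_scale pm.scale_sum_right)
  next
    fix A :: "'k^2^2" and x assume A: "A \<in> carrier GL2" and x: "x \<in> carrier ?S"
    have "\<delta> ((act ?S A x) l) = pm_scale (det A ^ psi p f l) (?\<rho> A (\<delta> (x l)))" if "l \<in> I" for l
      using that x \<delta>_act[OF A, of "x l" l] unfolding carrierS by (auto simp: rep_direct_sum_def PiE_iff)
    then show "(\<Phi> \<circ> \<Delta>) (act ?S A x) = ?\<rho> A ((\<Phi> \<circ> \<Delta>) x)"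
      by (simp add: \<Phi>_def \<Delta>_def mpoly_subst_sum embed_summand_scale act_summand)
  qed
  then show ?thesis unfolding I_def T_def V_def W_def .
qed

end
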